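(* Let $L$ be a lattice of signature $(2,b)$, $\Gamma$ a finite-index subgroup of $O^+(L)$, and $I$ a rank $1$ primitive isotropic sublattice of $L$. The following conditions are equivalent. (1) $U(I)_{\mathbb{Z}}\ne U(I)_{\mathbb{Z}}'$, where $U(I)_{\mathbb{Z}}'=U(I)_{\mathbb{Q}}\cap\langle\Gamma,-\mathrm{id}\rangle$. (2) $-\mathrm{id}\notin\Gamma$ and $-E_w\in\Gamma(I)_{\mathbb{Z}}$ for some $w\in L(I)_{\mathbb{Q}}$. (3) $-\mathrm{id}\notin\Gamma$ and the natural map $\overline{\Gamma(I)}_{\mathbb{Z}}\to O^+(U(I)_{\mathbb{Z}})$ is not injective. (4) $\overline{\Gamma(I)}_{\mathbb{Z}}$ contains an element which acts by a nonzero translation on $\mathcal{X}(I)=\mathcal{D}/U(I)_{\mathbb{Z}}$. When these hold, with $w$ as in (2), we have $U(I)_{\mathbb{Z}}'/U(I)_{\mathbb{Z}}=\langle E_w\rangle\simeq\mathbb{Z}/2$ and $\ker(\overline{\Gamma(I)}_{\mathbb{Z}}\to O^+(U(I)_{\mathbb{Z}}))=\langle -E_w\rangle\simeq\mathbb{Z}/2$, and the translation in (4) is given by $[w]\in U(I)_{\mathbb{Q}}/U(I)_{\mathbb{Z}}$ and is unique.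
   Context: A lattice is a free $\mathbb{Z}$-module of finite rank with a nondegenerate integral symmetric bilinear form $(\cdot,\cdot)$. $\mathcal{D}$ is a fixed connected component (of two) of $\{\mathbb{C}\omega\in\mathbb{P}L_{\mathbb{C}}:(\omega,\omega)=0,(\omega,\bar\omega)>0\}$; $O^+(L)$, $O^+(L_{\mathbb{Q}})$ are the subgroups of $O(L)$, $O(L_{\mathbb{Q}})$ preserving $\mathcal{D}$. $\langle\Gamma,-\mathrm{id}\rangle$ is the group generated by $\Gamma$ and $-\mathrm{id}$. Put $L(I)=((I^\perp\cap L)/I)\otimes I$, with the quadratic form induced from $I^\perp/I$ and any isomorphism $I\simeq\mathbb{Z}$; it has signature $(1,b-1)$. Let $\Gamma(I)_{\mathbb{Q}}$ be the stabilizer of $I$ in $O^+(L_{\mathbb{Q}})$ and $U(I)_{\mathbb{Q}}=\ker(\Gamma(I)_{\mathbb{Q}}\to O(I_{\mathbb{Q}}^\perp/I_{\mathbb{Q}})\times GL(I))$. For $m\otimes l\in L(I)_{\mathbb{Q}}$ the Eichler transvection is $E_{m\otimes l}(v)=v-(\tilde m,v)l+(l,v)\tilde m-\frac12(m,m)(l,v)l$ ($v\in L_{\mathbb{Q}}$, $\tilde m\in I_{\mathbb{Q}}^\perp$ any lift of $m$). The map $w\mapsto E_w$ is an isomorphism $L(I)_{\mathbb{Q}}\to U(I)_{\mathbb{Q}}$, by which the two are identified. Put $\Gamma(I)_{\mathbb{Z}}=\Gamma(I)_{\mathbb{Q}}\cap\Gamma$, $U(I)_{\mathbb{Z}}=U(I)_{\mathbb{Q}}\cap\Gamma$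 (a lattice in $U(I)_{\mathbb{Q}}$), $\overline{\Gamma(I)}_{\mathbb{Z}}=\Gamma(I)_{\mathbb{Z}}/U(I)_{\mathbb{Z}}$. The group $\Gamma(I)_{\mathbb{Z}}$ acts on $U(I)_{\mathbb{Z}}$ by conjugation, which is the natural action on $L(I)_{\mathbb{Q}}$; this gives the map $\overline{\Gamma(I)}_{\mathbb{Z}}\to O^+(U(I)_{\mathbb{Z}})$, where $O^+$ denotes the isometries preserving each component of the set of vectors of positive norm. Tube domain: choosing a generator $l$ of $I$ and a rank one sublattice $I'\subset L$ with $(I,I')\not\equiv0$, and $\omega'\in I'_{\mathbb{Q}}$ with $(\omega',l)=1$, the map $[\omega]\mapsto[\omega-\omega']\otimes l$ (with $(\omega,l)=1$) identifies $\mathcal{D}$ with $\mathcal{D}_I=\{Z\in L(I)_{\mathbb{C}}:\mathrm{Im}\,Z\in\mathcal{C}_I\}$, where $\mathcal{C}_I$ is a component of $\{w\in L(I)_{\mathbb{R}}:(w,w)>0\}$; $E_w$ acts by translation by $w$. So $\mathcal{X}(I)$ is identified with an open set in the torus $T(I)=U(I)_{\mathbb{C}}/U(I)_{\mathbb{Z}}$, where $U(I)_{\mathbb{C}}=L(I)_{\mathbb{C}}$; translations on $\mathcal{X}(I)$ are with respect to this torus (changing $I'$ only changes the identification by a translation). *)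

theory Defs
  imports
    "HOL-Analysis.Analysis"
    "HOL-Library.Set_Algebras"
    "HOL-Algebra.Coset"
    "HOL-Algebra.Bij"
    "HOL-Algebra.Generated_Groups"
    "HOL-Algebra.Elementary_Groups"
begin

section \<open>Lattices and their scalar extensions\<close>

text \<open>
  A lattice of rank \<open>n = CARD('n)\<close> is given, after the choice of a \<open>\<int>\<close>-basis, by its integral
  Gram matrix \<open>B\<close>.  All extensions of scalars live in the one space \<open>complex ^ 'n\<close>, which is
  \<open>L\<^sub>\<complex>\<close>: for a subring \<open>K\<close> of \<open>\<complex>\<close> the module \<open>L\<^sub>K\<close> is the set of vectors with
  coordinates in \<open>K\<close>, and \<open>\<rat>\<close>-linear maps of \<open>L\<^sub>\<rat>\<close> are represented by their
  \<open>\<complex>\<close>-linear extensions.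
\<close>

definition lat :: "complex set \<Rightarrow> (complex ^ 'n) set" where
  "lat K = {v. \<forall>i. v $ i \<in> K}"

definition bil :: "int ^ 'n ^ 'n \<Rightarrow> complex ^ 'n \<Rightarrow> complex ^ 'n \<Rightarrow> complex" where
  "bil B x y = (\<Sum>i\<in>UNIV. \<Sum>j\<in>UNIV. of_int (B $ i $ j) * x $ i * y $ j)"

definition conj_vec :: "complex ^ 'n \<Rightarrow> complex ^ 'n" where
  "conj_vec v = (\<chi> i. cnj (v $ i))"

definition is_lattice :: "int ^ 'n ^ 'n \<Rightarrow> bool" where
  "is_lattice B \<longleftrightarrow> transpose B = B \<and> det B \<noteq> 0"

definition has_signature :: "int ^ 'n ^ 'n \<Rightarrow> nat \<Rightarrow> nat \<Rightarrow> bool" where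
  "has_signature B p q \<longleftrightarrow>
     (\<exists>P :: real ^ 'n ^ 'n. invertible P \<and>
        (let M = transpose P ** map_matrix real_of_int B ** P in
           (\<forall>i j. i \<noteq> j \<longrightarrow> M $ i $ j = 0) \<and>
           card {i. M $ i $ i > 0} = p \<and> card {i. M $ i $ i < 0} = q))"

text \<open>For a module \<open>I\<close> of rank one, \<open>ext K I\<close> is \<open>I \<otimes> K\<close>; the module generated by \<open>l\<close>
  is \<open>ext \<int> {l}\<close>.\<close>

definition ext :: "complex set \<Rightarrow> (complex ^ 'n) set \<Rightarrow> (complex ^ 'n) set" where
  "ext K I = {c *s x | c x. c \<in> K \<and> x \<in> I}"

definition rank_one_sublattice :: "(complex ^ 'n) set \<Rightarrow> bool" where
  "rank_one_sublattice I \<longleftrightarrow> (\<exists>x\<in>lat \<int>. x \<noteq> 0 \<and> I = ext \<int> {x})"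

definition primitive :: "(complex ^ 'n) set \<Rightarrow> bool" where
  "primitive I \<longleftrightarrow> (\<forall>v\<in>lat \<int>. \<forall>k :: int. k \<noteq> 0 \<and> of_int k *s v \<in> I \<longrightarrow> v \<in> I)"

definition isotropic :: "int ^ 'n ^ 'n \<Rightarrow> (complex ^ 'n) set \<Rightarrow> bool" where
  "isotropic B I \<longleftrightarrow> (\<forall>x\<in>I. \<forall>y\<in>I. bil B x y = 0)"

text \<open>\<open>perp B I K\<close> is the orthogonal complement of \<open>I\<close> in \<open>L\<^sub>K\<close>.\<close>

definition perp :: "int ^ 'n ^ 'n \<Rightarrow> (complex ^ 'n) set \<Rightarrow> complex set \<Rightarrow> (complex ^ 'n) set" where
  "perp B I K = {v \<in> lat K. \<forall>x\<in>I. bil B v x = 0}"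


section \<open>The period domain\<close>

definition quotient_top :: "'a topology \<Rightarrow> ('a \<Rightarrow> 'b) \<Rightarrow> 'b topology" where
  "quotient_top X p =
     topology (\<lambda>U. U \<subseteq> p ` topspace X \<and> openin X {x \<in> topspace X. p x \<in> U})"

lemma openin_quotient_top:
  "openin (quotient_top X p) U \<longleftrightarrow> U \<subseteq> p ` topspace X \<and> openin X {x \<in> topspace X. p x \<in> U}"
proof -
  have "istopology (\<lambda>U. U \<subseteq> p ` topspace X \<and> openin X {x \<in> topspace X. p x \<in> U})"
    unfolding istopology_def
  proof (intro conjI allI impI)
    fix S T
    assume "S \<subseteq> p ` topspace X \<and> openin X {x \<in> topspace X. p x \<in> S}"
      and "T \<subseteq> p ` topspace X \<and> openin X {x \<in> topspace X. p x \<in> T}"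
    moreover have "{x \<in> topspace X. p x \<in> S \<inter> T} =
        {x \<in> topspace X. p x \<in> S} \<inter> {x \<in> topspace X. p x \<in> T}"
      by blast
    ultimately show "S \<inter> T \<subseteq> p ` topspace X" "openin X {x \<in> topspace X. p x \<in> S \<inter> T}"
      by auto
  next
    fix \<U>
    assume *: "\<forall>K\<in>\<U>. K \<subseteq> p ` topspace X \<and> openin X {x \<in> topspace X. p x \<in> K}"
    then show "\<Union>\<U> \<subseteq> p ` topspace X"
      by blast
    have "{x \<in> topspace X. p x \<in> \<Union>\<U>} = (\<Union>K\<in>\<U>. {x \<in> topspace X. p x \<in> K})"
      by blast
    then show "openin X {x \<in> topspace X. p x \<in> \<Union>\<U>}"
      using * by auto
  qed
  then show ?thesis
    by (simp add: quotient_top_def topology_inverse')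
qed

definition line :: "complex ^ 'n \<Rightarrow> (complex ^ 'n) set" where
  "line v = range (\<lambda>c. c *s v)"

definition proj_top :: "(complex ^ 'n) set topology" where
  "proj_top = quotient_top (top_of_set (- {0})) line"

text \<open>The component \<open>\<D>\<close> is one of the two elements of this set.\<close>

definition period_components :: "int ^ 'n ^ 'n \<Rightarrow> (complex ^ 'n) set set set" where
  "period_components B =
     connected_components_of (subtopology proj_top
       {line \<omega> | \<omega>. bil B \<omega> \<omega> = 0 \<and> Re (bil B \<omega> (conj_vec \<omega>)) > 0})"


section \<open>Orthogonal groups\<close>

definition comp_group :: "('a \<Rightarrow> 'a) set \<Rightarrow> ('a \<Rightarrow> 'a) monoid" where
  "comp_group S = \<lparr>carrier = S, mult = (\<circ>), one = id\<rparr>"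

definition orth_Q :: "int ^ 'n ^ 'n \<Rightarrow> (complex ^ 'n \<Rightarrow> complex ^ 'n) set" where
  "orth_Q B = {g. Vector_Spaces.linear (*s) (*s) g \<and> g ` lat \<rat> = lat \<rat> \<and>
                  (\<forall>x y. bil B (g x) (g y) = bil B x y)}"

definition Oplus_Q ::
    "int ^ 'n ^ 'n \<Rightarrow> (complex ^ 'n) set set \<Rightarrow> (complex ^ 'n \<Rightarrow> complex ^ 'n) set" where
  "Oplus_Q B \<D> = {g \<in> orth_Q B. (\<lambda>x. g ` x) ` \<D> = \<D>}"

definition Oplus ::
    "int ^ 'n ^ 'n \<Rightarrow> (complex ^ 'n) set set \<Rightarrow> (complex ^ 'n \<Rightarrow> complex ^ 'n) set" where
  "Oplus B \<D> = {g \<in> Oplus_Q B \<D>. g ` lat \<int> = lat \<int>}"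

definition finite_index_subgroup :: "'a set \<Rightarrow> ('a, 'm) monoid_scheme \<Rightarrow> bool" where
  "finite_index_subgroup H G \<longleftrightarrow> subgroup H G \<and> finite (rcosets\<^bsub>G\<^esub> H)"


section \<open>The quadratic space \<open>L(I)\<close>\<close>

text \<open>
  \<open>(I\<^sup>\<bottom> / I) \<otimes> I\<close> is formed as \<open>(I\<^sup>\<bottom> \<otimes> I) / (I \<otimes> I)\<close> inside \<open>(L \<otimes> L) / (I \<otimes> I)\<close> over
  \<open>\<complex>\<close>, with \<open>L\<^sub>\<complex> \<otimes> L\<^sub>\<complex>\<close> the space of matrices.  As \<open>I\<close> has rank one, every element
  is a pure tensor \<open>m \<otimes> x\<close>, represented by the coset \<open>tens I m x\<close>.  The sum of two cosets is
  their elementwise sum as sets, and the zero element is \<open>tens_II I\<close>.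
\<close>

definition outer :: "complex ^ 'n \<Rightarrow> complex ^ 'n \<Rightarrow> complex ^ 'n ^ 'n" where
  "outer m x = (\<chi> i j. m $ i * x $ j)"

definition tens_II :: "(complex ^ 'n) set \<Rightarrow> (complex ^ 'n ^ 'n) set" where
  "tens_II I = {outer x y | x y. x \<in> ext UNIV I \<and> y \<in> ext UNIV I}"

definition tens :: "(complex ^ 'n) set \<Rightarrow> complex ^ 'n \<Rightarrow> complex ^ 'n \<Rightarrow> (complex ^ 'n ^ 'n) set" where
  "tens I m x = {outer m x} + tens_II I"

definition LI ::
    "int ^ 'n ^ 'n \<Rightarrow> (complex ^ 'n) set \<Rightarrow> complex set \<Rightarrow> (complex ^ 'n ^ 'n) set set" where
  "LI B I K = {tens I m x | m x. m \<in> perp B I K \<and> x \<in> ext K I}"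

definition LI_group ::
    "int ^ 'n ^ 'n \<Rightarrow> (complex ^ 'n) set \<Rightarrow> complex set \<Rightarrow> (complex ^ 'n ^ 'n) set monoid" where
  "LI_group B I K = \<lparr>carrier = LI B I K, mult = (+), one = tens_II I\<rparr>"

definition LI_scale ::
    "(complex ^ 'n) set \<Rightarrow> real \<Rightarrow> (complex ^ 'n ^ 'n) set \<Rightarrow> (complex ^ 'n ^ 'n) set" where
  "LI_scale I r w = (\<lambda>A. r *\<^sub>R A) ` w + tens_II I"

text \<open>The value does not depend on the generator \<open>l\<close> of \<open>I\<close>, i.e. on the isomorphism
  \<open>I \<simeq> \<int>\<close>.\<close>

definition LI_form ::
    "int ^ 'n ^ 'n \<Rightarrow> (complex ^ 'n) set \<Rightarrow>
     (complex ^ 'n ^ 'n) set \<Rightarrow> (complex ^ 'n ^ 'n) set \<Rightarrow> complex" where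
  "LI_form B I w w' =
     the_elem {bil B m m' | m m' l. m \<in> perp B I UNIV \<and> m' \<in> perp B I UNIV \<and>
                 I = ext \<int> {l} \<and> w = tens I m l \<and> w' = tens I m' l}"

definition LI_positive_components ::
    "int ^ 'n ^ 'n \<Rightarrow> (complex ^ 'n) set \<Rightarrow> (complex ^ 'n ^ 'n) set set set" where
  "LI_positive_components B I =
     connected_components_of (subtopology
       (quotient_top (top_of_set {outer m x | m x. m \<in> perp B I \<real> \<and> x \<in> ext \<real> I})
          (\<lambda>A. {A} + tens_II I))
       {w \<in> LI B I \<real>. Re (LI_form B I w w) > 0})"


section \<open>Stabilizers of \<open>I\<close> and Eichler transvections\<close>

definition GammaI_Q ::
    "int ^ 'n ^ 'n \<Rightarrow> (complex ^ 'n) set set \<Rightarrow> (complex ^ 'n) set \<Rightarrow>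
     (complex ^ 'n \<Rightarrow> complex ^ 'n) set" where
  "GammaI_Q B \<D> I = {g \<in> Oplus_Q B \<D>. g ` I = I}"

definition UI_Q ::
    "int ^ 'n ^ 'n \<Rightarrow> (complex ^ 'n) set set \<Rightarrow> (complex ^ 'n) set \<Rightarrow>
     (complex ^ 'n \<Rightarrow> complex ^ 'n) set" where
  "UI_Q B \<D> I = {g \<in> GammaI_Q B \<D> I.
      (\<forall>v\<in>perp B I \<rat>. g v - v \<in> ext \<rat> I) \<and> (\<forall>x\<in>I. g x = x)}"

definition GammaI_Z ::
    "int ^ 'n ^ 'n \<Rightarrow> (complex ^ 'n) set set \<Rightarrow> (complex ^ 'n \<Rightarrow> complex ^ 'n) set \<Rightarrow>
     (complex ^ 'n) set \<Rightarrow> (complex ^ 'n \<Rightarrow> complex ^ 'n) set" where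
  "GammaI_Z B \<D> \<Gamma> I = GammaI_Q B \<D> I \<inter> \<Gamma>"

definition UI_Z ::
    "int ^ 'n ^ 'n \<Rightarrow> (complex ^ 'n) set set \<Rightarrow> (complex ^ 'n \<Rightarrow> complex ^ 'n) set \<Rightarrow>
     (complex ^ 'n) set \<Rightarrow> (complex ^ 'n \<Rightarrow> complex ^ 'n) set" where
  "UI_Z B \<D> \<Gamma> I = UI_Q B \<D> I \<inter> \<Gamma>"

definition UI_Z' ::
    "int ^ 'n ^ 'n \<Rightarrow> (complex ^ 'n) set set \<Rightarrow> (complex ^ 'n \<Rightarrow> complex ^ 'n) set \<Rightarrow>
     (complex ^ 'n) set \<Rightarrow> (complex ^ 'n \<Rightarrow> complex ^ 'n) set" where
  "UI_Z' B \<D> \<Gamma> I = UI_Q B \<D> I \<inter> generate (comp_group (Oplus_Q B \<D>)) (\<Gamma> \<union> {uminus})"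

definition GammaI_bar ::
    "int ^ 'n ^ 'n \<Rightarrow> (complex ^ 'n) set set \<Rightarrow> (complex ^ 'n \<Rightarrow> complex ^ 'n) set \<Rightarrow>
     (complex ^ 'n) set \<Rightarrow> (complex ^ 'n \<Rightarrow> complex ^ 'n) set monoid" where
  "GammaI_bar B \<D> \<Gamma> I = comp_group (GammaI_Z B \<D> \<Gamma> I) Mod UI_Z B \<D> \<Gamma> I"

text \<open>\<open>eichler B m l\<close> depends only on the class of \<open>m \<otimes> l\<close> for \<open>m \<in> I\<^sup>\<bottom>\<close> and
  \<open>l \<in> I\<close>, so \<open>transvection B I w\<close> is \<open>E\<^sub>w\<close>, computed from any lift.\<close>

definition eichler ::
    "int ^ 'n ^ 'n \<Rightarrow> complex ^ 'n \<Rightarrow> complex ^ 'n \<Rightarrow> complex ^ 'n \<Rightarrow> complex ^ 'n" where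
  "eichler B m l v =
     v - bil B m v *s l + bil B l v *s m - (1 / 2 * bil B m m * bil B l v) *s l"

definition transvection ::
    "int ^ 'n ^ 'n \<Rightarrow> (complex ^ 'n) set \<Rightarrow> (complex ^ 'n ^ 'n) set \<Rightarrow>
     complex ^ 'n \<Rightarrow> complex ^ 'n" where
  "transvection B I w =
     the_elem {eichler B m l | m l. m \<in> perp B I UNIV \<and> l \<in> ext UNIV I \<and> w = tens I m l}"

text \<open>\<open>UI_lattice\<close> is \<open>U(I)\<^sub>\<int>\<close> regarded as a lattice in \<open>L(I)\<^sub>\<rat>\<close> through
  \<open>w \<mapsto> E\<^sub>w\<close>.\<close>

definition UI_lattice ::
    "int ^ 'n ^ 'n \<Rightarrow> (complex ^ 'n) set set \<Rightarrow> (complex ^ 'n \<Rightarrow> complex ^ 'n) set \<Rightarrow>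
     (complex ^ 'n) set \<Rightarrow> (complex ^ 'n ^ 'n) set set" where
  "UI_lattice B \<D> \<Gamma> I = {w \<in> LI B I \<rat>. transvection B I w \<in> UI_Z B \<D> \<Gamma> I}"

text \<open>The real scalar extension of an isometry of the lattice is the map \<open>F\<close> below.\<close>

definition Oplus_UI ::
    "int ^ 'n ^ 'n \<Rightarrow> (complex ^ 'n) set set \<Rightarrow> (complex ^ 'n \<Rightarrow> complex ^ 'n) set \<Rightarrow>
     (complex ^ 'n) set \<Rightarrow> ((complex ^ 'n ^ 'n) set \<Rightarrow> (complex ^ 'n ^ 'n) set) monoid" where
  "Oplus_UI B \<D> \<Gamma> I =
     (let \<Lambda> = UI_lattice B \<D> \<Gamma> I; A = AutoGroup (LI_group B I \<rat> \<lparr>carrier := \<Lambda>\<rparr>) in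
      A \<lparr>carrier := {f \<in> carrier A.
           (\<forall>u\<in>\<Lambda>. \<forall>v\<in>\<Lambda>. LI_form B I (f u) (f v) = LI_form B I u v) \<and>
           (\<exists>F. F ` LI B I \<real> \<subseteq> LI B I \<real> \<and>
                (\<forall>x\<in>LI B I \<real>. \<forall>y\<in>LI B I \<real>. F (x + y) = F x + F y) \<and>
                (\<forall>r. \<forall>x\<in>LI B I \<real>. F (LI_scale I r x) = LI_scale I r (F x)) \<and>
                (\<forall>u\<in>\<Lambda>. F u = f u) \<and>
                (\<forall>K\<in>LI_positive_components B I. F ` K = K))}\<rparr>)"

definition conj_action ::
    "int ^ 'n ^ 'n \<Rightarrow> (complex ^ 'n) set set \<Rightarrow> (complex ^ 'n \<Rightarrow> complex ^ 'n) set \<Rightarrow>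
     (complex ^ 'n) set \<Rightarrow> (complex ^ 'n \<Rightarrow> complex ^ 'n) \<Rightarrow>
     (complex ^ 'n ^ 'n) set \<Rightarrow> (complex ^ 'n ^ 'n) set" where
  "conj_action B \<D> \<Gamma> I g =
     (\<lambda>w\<in>UI_lattice B \<D> \<Gamma> I. inv_into (LI B I \<rat>) (transvection B I)
        (g \<circ> transvection B I w \<circ> inv\<^bsub>comp_group (GammaI_Z B \<D> \<Gamma> I)\<^esub> g))"

text \<open>\<open>conj_action\<close> is constant on the cosets of the abelian group \<open>U(I)\<^sub>\<int>\<close>.\<close>

definition natural_map ::
    "int ^ 'n ^ 'n \<Rightarrow> (complex ^ 'n) set set \<Rightarrow> (complex ^ 'n \<Rightarrow> complex ^ 'n) set \<Rightarrow>
     (complex ^ 'n) set \<Rightarrow> (complex ^ 'n \<Rightarrow> complex ^ 'n) set \<Rightarrow>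
     (complex ^ 'n ^ 'n) set \<Rightarrow> (complex ^ 'n ^ 'n) set" where
  "natural_map B \<D> \<Gamma> I C = the_elem (conj_action B \<D> \<Gamma> I ` C)"


section \<open>The tube domain and translations\<close>

definition XI ::
    "int ^ 'n ^ 'n \<Rightarrow> (complex ^ 'n) set set \<Rightarrow> (complex ^ 'n \<Rightarrow> complex ^ 'n) set \<Rightarrow>
     (complex ^ 'n) set \<Rightarrow> (complex ^ 'n) set set set" where
  "XI B \<D> \<Gamma> I = {{g ` x | g. g \<in> UI_Z B \<D> \<Gamma> I} | x. x \<in> \<D>}"

definition XI_action ::
    "(complex ^ 'n \<Rightarrow> complex ^ 'n) set \<Rightarrow> (complex ^ 'n) set set \<Rightarrow> (complex ^ 'n) set set" where
  "XI_action C X = {g ` x | g x. g \<in> C \<and> x \<in> X}"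

definition torus ::
    "int ^ 'n ^ 'n \<Rightarrow> (complex ^ 'n) set set \<Rightarrow> (complex ^ 'n \<Rightarrow> complex ^ 'n) set \<Rightarrow>
     (complex ^ 'n) set \<Rightarrow> (complex ^ 'n ^ 'n) set set monoid" where
  "torus B \<D> \<Gamma> I = LI_group B I UNIV Mod UI_lattice B \<D> \<Gamma> I"

definition tube_data ::
    "int ^ 'n ^ 'n \<Rightarrow> (complex ^ 'n) set \<Rightarrow> complex ^ 'n \<Rightarrow> (complex ^ 'n) set \<Rightarrow> complex ^ 'n \<Rightarrow> bool"
    where
  "tube_data B I l I' \<omega>' \<longleftrightarrow>
     I = ext \<int> {l} \<and>
     rank_one_sublattice I' \<and> (\<exists>x\<in>I. \<exists>y\<in>I'. bil B x y \<noteq> 0) \<and>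
     \<omega>' \<in> ext \<rat> I' \<and> bil B \<omega>' l = 1"

text \<open>Each line in \<open>\<D>\<close> contains exactly one \<open>\<omega>\<close> with \<open>(\<omega>, l) = 1\<close>.\<close>

definition tube ::
    "int ^ 'n ^ 'n \<Rightarrow> (complex ^ 'n) set \<Rightarrow> complex ^ 'n \<Rightarrow> complex ^ 'n \<Rightarrow>
     (complex ^ 'n) set \<Rightarrow> (complex ^ 'n ^ 'n) set" where
  "tube B I l \<omega>' x = the_elem {tens I (\<omega> - \<omega>') l | \<omega>. \<omega> \<in> x \<and> bil B \<omega> l = 1}"

text \<open>
  The tube realization carries the \<open>U(I)\<^sub>\<int>\<close>-orbit \<open>X \<in> XI\<close> to a coset of the lattice, so
  that \<open>tube B I l \<omega>' ` X\<close> is the point of the torus corresponding to \<open>X\<close>.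
\<close>

definition acts_by_translation ::
    "int ^ 'n ^ 'n \<Rightarrow> (complex ^ 'n) set set \<Rightarrow> (complex ^ 'n \<Rightarrow> complex ^ 'n) set \<Rightarrow>
     (complex ^ 'n) set \<Rightarrow> complex ^ 'n \<Rightarrow> complex ^ 'n \<Rightarrow>
     (complex ^ 'n \<Rightarrow> complex ^ 'n) set \<Rightarrow> (complex ^ 'n ^ 'n) set set \<Rightarrow> bool" where
  "acts_by_translation B \<D> \<Gamma> I l \<omega>' C t \<longleftrightarrow>
     (\<forall>X\<in>XI B \<D> \<Gamma> I.
        tube B I l \<omega>' ` XI_action C X = tube B I l \<omega>' ` X \<otimes>\<^bsub>torus B \<D> \<Gamma> I\<^esub> t)"

definition nonzero_translations ::
    "int ^ 'n ^ 'n \<Rightarrow> (complex ^ 'n) set set \<Rightarrow> (complex ^ 'n \<Rightarrow> complex ^ 'n) set \<Rightarrow>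
     (complex ^ 'n) set \<Rightarrow> complex ^ 'n \<Rightarrow> complex ^ 'n \<Rightarrow> (complex ^ 'n ^ 'n) set set set" where
  "nonzero_translations B \<D> \<Gamma> I l \<omega>' =
     {t \<in> carrier (torus B \<D> \<Gamma> I). t \<noteq> \<one>\<^bsub>torus B \<D> \<Gamma> I\<^esub> \<and>
        (\<exists>C\<in>carrier (GammaI_bar B \<D> \<Gamma> I). acts_by_translation B \<D> \<Gamma> I l \<omega>' C t)}"

end

theory Submission
  imports Defs
begin

text \<open>
  Everything reduces to the transvections \<open>e m = E_(m \<otimes> l)\<close> for rational \<open>m \<in> I\<^sup>\<bottom>\<close>, where \<open>l\<close> generates
  \<open>I\<close> and \<open>q m\<close> is the class of \<open>m \<otimes> l\<close> in \<open>L(I)\<close>.  They make up \<open>U(I)\<^sub>\<rat>\<close>: an element \<open>g\<close> of that group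
  is determined by \<open>u = g w' - w'\<close>, where \<open>(w', l) = 1\<close>, because invariance of the form forces
  \<open>g = e u\<close> first on \<open>I\<^sup>\<bottom>\<close> and then on \<open>w'\<close> (\<open>UQ_imp_transvection\<close>).  Hence an element of
  \<open>\<Gamma>(I)\<^sub>\<rat>\<close> that acts trivially on \<open>L(I) = (I\<^sup>\<bottom> / I) \<otimes> I\<close> is \<open>e m\<close> or \<open>- e m\<close>: it acts by the
  same sign \<open>\<epsilon>\<close> on \<open>I\<close> and on \<open>I\<^sup>\<bottom> / I\<close>, so \<open>\<epsilon>\<close> times it is unipotent (\<open>sign_twist_unipotent\<close>).
  Each of the four conditions then says that \<open>-id \<notin> \<Gamma>\<close> and that some \<open>- e m\<close> lies in \<open>\<Gamma>\<close>.

  For (1) this is immediate from \<open>\<langle>\<Gamma>, -id\<rangle> = \<Gamma> \<union> -\<Gamma>\<close>.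

  For (3), \<open>g\<close> conjugates \<open>e m\<close> to the transvection of \<open>g m \<otimes> g l\<close>.  Two elements of \<open>\<Gamma>(I)\<^sub>\<int>\<close> with the
  same image in \<open>O(U(I)\<^sub>\<int>)\<close> therefore act in the same way on those \<open>q m\<close> with \<open>e m \<in> \<Gamma>\<close>.  As \<open>\<Gamma>\<close>
  has finite index, every rational \<open>m\<close> has a positive multiple of this kind (\<open>multiple_in_Gamma\<close>), so they act
  in the same way on all of \<open>L(I)\<^sub>\<rat>\<close>, and their quotient is some \<open>e m\<close> or \<open>- e m\<close>.

  For (4), \<open>e m\<close> and \<open>- e m\<close> act on \<open>\<D>\<close> as translation by \<open>q m\<close> (\<open>tube_translate\<close>).  Conversely, let \<open>g\<close>
  translate \<open>\<X>(I)\<close> by the class of \<open>n\<close>, and let \<open>g l = \<epsilon> l\<close>.  For a period \<open>\<omega>\<close> with \<open>(\<omega>, l) = 1\<close>,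
  the vector \<open>\<epsilon> g \<omega> - \<omega> - n\<close> is rational modulo \<open>l\<close>.  Moving \<open>\<omega>\<close> by the real transvection
  \<open>e (s m)\<close>, with \<open>m\<close> rational and \<open>s\<close> irrational, changes it by \<open>s (\<epsilon> g m - m)\<close> modulo \<open>l\<close>; an
  irrational multiple of a rational vector is rational modulo \<open>l\<close> only if the vector is a multiple
  of \<open>l\<close>.  So \<open>\<epsilon> g m = m\<close> modulo \<open>I\<^sub>\<rat>\<close>, and \<open>g\<close> is again \<open>e m\<close> or \<open>- e m\<close>
  (\<open>translation_imp_transvection\<close>).

  Two analytic facts enter: real transvections preserve the component \<open>\<D>\<close>, since \<open>t \<mapsto> e (t m)\<close>
  joins them to the identity (\<open>real_transvection_D\<close>), and no period is orthogonal to \<open>l\<close>, since a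
  positive definite plane has no nonzero isotropic vector orthogonal to it in signature \<open>(2, b)\<close>
  (\<open>period_not_orthogonal_to_isotropic\<close>).

  The statements on groups of order two hold because any \<open>- e m\<close> and \<open>- e m'\<close> in \<open>\<Gamma>\<close> differ by
  \<open>e (m' - m) \<in> U(I)\<^sub>\<int>\<close>.
\<close>

section \<open>Groups of permutations under composition\<close>

definition perm_group :: "('a \<Rightarrow> 'a) set \<Rightarrow> bool" where
  "perm_group S \<longleftrightarrow> id \<in> S \<and> (\<forall>g\<in>S. \<forall>h\<in>S. g \<circ> h \<in> S) \<and> (\<forall>g\<in>S. bij g \<and> inv_into UNIV g \<in> S)"

lemma carrier_comp_group [simp]: "carrier (comp_group S) = S"
  and mult_comp_group [simp]: "x \<otimes>\<^bsub>comp_group S\<^esub> y = x \<circ> y"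
  and one_comp_group [simp]: "\<one>\<^bsub>comp_group S\<^esub> = id"
  by (auto simp: comp_group_def)

lemma inv_comp_inv:
  assumes "bij g" shows "g \<circ> inv_into UNIV g = id" "inv_into UNIV g \<circ> g = id"
  using assms by (auto simp: bij_def surj_iff inj_iff)

lemma perm_group_group:
  assumes "perm_group S" shows "group (comp_group S)"
proof (rule groupI; simp)
  show "\<exists>y\<in>S. y \<circ> x = id" if "x \<in> S" for x
    using assms that unfolding perm_group_def using inv_comp_inv(2) by metis
qed (use assms in \<open>auto simp: perm_group_def comp_assoc\<close>)

lemma perm_group_m_inv:
  assumes "perm_group S" "g \<in> S" shows "inv\<^bsub>comp_group S\<^esub> g = inv_into UNIV g"
  by (rule group.inv_equality[OF perm_group_group])
     (use assms in \<open>auto simp: perm_group_def inv_comp_inv\<close>)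

lemma perm_group_subgroup:
  assumes "perm_group S" "perm_group T" "T \<subseteq> S" shows "subgroup T (comp_group S)"
  by (rule group.subgroupI[OF perm_group_group[OF assms(1)]])
     (use assms perm_group_m_inv[OF assms(1)] in \<open>auto simp: perm_group_def subset_iff\<close>)

lemma subgroup_perm_group:
  assumes "perm_group S" "subgroup T (comp_group S)" shows "perm_group T"
  using assms subgroup.m_inv_closed[OF assms(2)] subgroup.m_closed[OF assms(2)]
    subgroup.one_closed[OF assms(2)] subgroup.subset[OF assms(2)]
    perm_group_m_inv[OF assms(1)]
  by (simp add: perm_group_def subset_iff)

lemma perm_group_Int:
  assumes "perm_group S" "perm_group T" shows "perm_group (S \<inter> T)"
  using assms by (auto simp: perm_group_def)

lemma comp_group_coset: "H #>\<^bsub>comp_group S\<^esub> g = (\<lambda>u. u \<circ> g) ` H"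
  by (auto simp: r_coset_def)

text \<open>
  Right cosets are compared by the quotient on the right, \<open>g h\<inverse>\<close>; this is the form in which
  the later sections decide whether two classes agree.
\<close>

lemma comp_group_coset_eq_iff:
  assumes "perm_group S" "perm_group H" "H \<subseteq> S" "g \<in> S" "h \<in> S"
  shows "H #>\<^bsub>comp_group S\<^esub> g = H #>\<^bsub>comp_group S\<^esub> h \<longleftrightarrow> g \<circ> inv_into UNIV h \<in> H"
proof
  assume "H #>\<^bsub>comp_group S\<^esub> g = H #>\<^bsub>comp_group S\<^esub> h"
  moreover have "g \<in> H #>\<^bsub>comp_group S\<^esub> g"
    using assms(2) unfolding comp_group_coset perm_group_def by (metis comp_id fun.map_id image_eqI id_comp)
  ultimately obtain u where u: "u \<in> H" "g = u \<circ> h" by (auto simp: comp_group_coset)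
  have "bij h" using assms by (auto simp: perm_group_def)
  then have "g \<circ> inv_into UNIV h = u" by (simp only: u comp_assoc inv_comp_inv comp_id)
  then show "g \<circ> inv_into UNIV h \<in> H" using u by simp
next
  assume u: "g \<circ> inv_into UNIV h \<in> H" (is "?u \<in> H")
  have "bij h" using assms by (auto simp: perm_group_def)
  then have g: "g = ?u \<circ> h" by (simp only: comp_assoc inv_comp_inv comp_id)
  have "?u \<circ> h \<in> H #>\<^bsub>comp_group S\<^esub> h" using u by (auto simp: comp_group_coset)
  then have "g \<in> H #>\<^bsub>comp_group S\<^esub> h" using g by metis
  from group.repr_independence[OF perm_group_group[OF assms(1)] this _ perm_group_subgroup[OF assms(1-3)]]
  show "H #>\<^bsub>comp_group S\<^esub> g = H #>\<^bsub>comp_group S\<^esub> h"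
    using assms(5) by simp
qed

text \<open>
  Both groups of order two in the theorem, \<open>U(I)'\<^sub>\<int> / U(I)\<^sub>\<int>\<close> and the kernel of the natural map,
  are recognised through an involution that generates them.
\<close>

lemma involution_subgroup:
  assumes "group G" and a: "a \<in> carrier G" "a \<otimes>\<^bsub>G\<^esub> a = \<one>\<^bsub>G\<^esub>" "a \<noteq> \<one>\<^bsub>G\<^esub>"
  shows "generate G {a} = {\<one>\<^bsub>G\<^esub>, a}"
    and "G\<lparr>carrier := {\<one>\<^bsub>G\<^esub>, a}\<rparr> \<cong> integer_mod_group 2"
proof -
  interpret group G by fact
  have inv: "inv\<^bsub>G\<^esub> a = a" using inv_equality[OF a(2) a(1) a(1)] .
  have "subgroup {\<one>\<^bsub>G\<^esub>, a} G"
    by (rule subgroupI) (use a inv in auto)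
  then have "generate G {a} \<subseteq> {\<one>\<^bsub>G\<^esub>, a}" by (intro generate_subgroup_incl) auto
  then show "generate G {a} = {\<one>\<^bsub>G\<^esub>, a}"
    using generate.incl[of a "{a}" G] generate.one[of G "{a}"] by blast
  define f where "f x = (if x = a then 1 else 0 :: int)" for x
  have "f \<in> iso (G\<lparr>carrier := {\<one>\<^bsub>G\<^esub>, a}\<rparr>) (integer_mod_group 2)"
  proof (rule isoI)
    show "f \<in> hom (G\<lparr>carrier := {\<one>\<^bsub>G\<^esub>, a}\<rparr>) (integer_mod_group 2)"
      by (rule homI) (use a in \<open>auto simp: f_def carrier_integer_mod_group\<close>)
    have "{0..<2} = {0, 1 :: int}" by auto
    then show "bij_betw f (carrier (G\<lparr>carrier := {\<one>\<^bsub>G\<^esub>, a}\<rparr>)) (carrier (integer_mod_group 2))"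
      using a by (auto simp: bij_betw_def inj_on_def f_def carrier_integer_mod_group)
  qed
  then show "G\<lparr>carrier := {\<one>\<^bsub>G\<^esub>, a}\<rparr> \<cong> integer_mod_group 2" by (auto simp: is_iso_def)
qed

section \<open>The bilinear form\<close>

lemma bil_add_left: "bil B (x + y) z = bil B x z + bil B y z"
  and bil_add_right: "bil B z (x + y) = bil B z x + bil B z y"
  and bil_scale_left: "bil B (c *s x) z = c * bil B x z"
  and bil_scale_right: "bil B z (c *s x) = c * bil B z x"
  by (auto simp: bil_def algebra_simps sum.distrib sum_distrib_left)

lemma bil_minus_left: "bil B (- x) z = - bil B x z"
  and bil_minus_right: "bil B z (- x) = - bil B z x"
  by (auto simp: bil_def sum_negf)

lemma bil_diff_left: "bil B (x - y) z = bil B x z - bil B y z"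
  and bil_diff_right: "bil B z (x - y) = bil B z x - bil B z y"
  using bil_add_left[of B x "-y" z] bil_add_right[of B z x "-y"]
  by (auto simp: bil_minus_left bil_minus_right)

lemmas bil_simps = bil_add_left bil_add_right bil_scale_left bil_scale_right
  bil_minus_left bil_minus_right bil_diff_left bil_diff_right

lemma bil_commute:
  assumes "transpose B = B" shows "bil B x y = bil B y x"
proof -
  have "B $ i $ j = B $ j $ i" for i j
    using assms by (metis transpose_def vec_lambda_beta)
  then show ?thesis unfolding bil_def
    by (subst sum.swap) (auto intro!: sum.cong)
qed

lemma bil_conj: "bil B (conj_vec x) (conj_vec y) = cnj (bil B x y)"
  by (simp add: bil_def conj_vec_def)

lemma conj_vec_simps:
  "conj_vec (x + y) = conj_vec x + conj_vec y" "conj_vec (x - y) = conj_vec x - conj_vec y"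
  "conj_vec (c *s x) = cnj c *s conj_vec x" "conj_vec (conj_vec x) = x"
  by (auto simp: conj_vec_def vec_eq_iff)

lemma conj_vec_real: "x \<in> lat \<real> \<Longrightarrow> conj_vec x = x"
  by (auto simp: lat_def conj_vec_def vec_eq_iff Reals_cnj_iff)

lemma lat_Rats_closed:
  "0 \<in> lat \<rat>"
  "x \<in> lat \<rat> \<Longrightarrow> y \<in> lat \<rat> \<Longrightarrow> x + y \<in> lat \<rat>" "x \<in> lat \<rat> \<Longrightarrow> y \<in> lat \<rat> \<Longrightarrow> x - y \<in> lat \<rat>"
  "c \<in> \<rat> \<Longrightarrow> x \<in> lat \<rat> \<Longrightarrow> c *s x \<in> lat \<rat>" "x \<in> lat \<rat> \<Longrightarrow> - x \<in> lat \<rat>"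
  by (auto simp: lat_def)

lemma lat_Ints_closed:
  "x \<in> lat \<int> \<Longrightarrow> y \<in> lat \<int> \<Longrightarrow> x + y \<in> lat \<int>" "x \<in> lat \<int> \<Longrightarrow> y \<in> lat \<int> \<Longrightarrow> x - y \<in> lat \<int>"
  "c \<in> \<int> \<Longrightarrow> x \<in> lat \<int> \<Longrightarrow> c *s x \<in> lat \<int>"
  by (auto simp: lat_def)

lemma lat_Ints_Rats: "x \<in> lat \<int> \<Longrightarrow> x \<in> lat \<rat>"
  unfolding lat_def using Ints_subset_Rats by blast

lemma Rats_complex_real: "(x :: complex) \<in> \<rat> \<Longrightarrow> x \<in> \<real>"
  by (metis Rats_cases' Reals_divide Reals_of_int)

lemma lat_Rats_Reals: "x \<in> lat \<rat> \<Longrightarrow> x \<in> lat \<real>"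
  by (auto simp: lat_def Rats_complex_real)

lemma bil_Rats: "x \<in> lat \<rat> \<Longrightarrow> y \<in> lat \<rat> \<Longrightarrow> bil B x y \<in> \<rat>"
  by (auto simp: bil_def lat_def intro!: Rats_sum Rats_mult)

lemma bil_Ints: "x \<in> lat \<int> \<Longrightarrow> y \<in> lat \<int> \<Longrightarrow> bil B x y \<in> \<int>"
  by (auto simp: bil_def lat_def intro!: Ints_sum Ints_mult)

lemma rational_vector_clear_denominators:
  fixes m :: "complex ^ 'n"
  assumes "m \<in> lat \<rat>"
  shows "\<exists>d :: nat. d > 0 \<and> of_nat d *s m \<in> lat \<int>"
proof -
  have "\<exists>d::nat. d > 0 \<and> of_nat d * m $ i \<in> \<int>" for i
  proof -
    have "m $ i \<in> \<rat>" using assms by (simp add: lat_def)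
    then obtain a b where "b > 0" "m $ i = of_int a / of_int b" by (rule Rats_cases')
    then show ?thesis by (intro exI[of _ "nat b"]) auto
  qed
  then obtain d where d: "\<And>i. d i > (0::nat)" "\<And>i. of_nat (d i) * m $ i \<in> \<int>" by metis
  have "of_nat (\<Prod>i\<in>UNIV. d i) * m $ j \<in> \<int>" for j
  proof -
    have "(\<Prod>i\<in>UNIV. d i) = d j * (\<Prod>i\<in>UNIV - {j}. d i)"
      by (simp add: prod.remove)
    then have "of_nat (\<Prod>i\<in>UNIV. d i) * m $ j = of_nat (\<Prod>i\<in>UNIV - {j}. d i) * (of_nat (d j) * m $ j)"
      by (simp only: of_nat_mult mult_ac)
    then show ?thesis using d by (metis Ints_mult Ints_of_nat)
  qed
  moreover have "(\<Prod>i\<in>UNIV. d i) > 0" using d by (simp add: prod_pos)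
  ultimately show ?thesis by (intro exI[of _ "\<Prod>i\<in>UNIV. d i"]) (simp add: lat_def)
qed

lemma linear_simps:
  fixes f :: "complex ^ 'n \<Rightarrow> complex ^ 'n"
  assumes "Vector_Spaces.linear (*s) (*s) f"
  shows "f (x + y) = f x + f y" "f (x - y) = f x - f y" "f (c *s x) = c *s f x" "f (- x) = - f x"
    "f 0 = 0" "f (\<Sum>i\<in>(UNIV :: 'n set). g i) = (\<Sum>i\<in>UNIV. f (g i))"
proof -
  interpret f: Vector_Spaces.linear "(*s)" "(*s)" f by fact
  show "f (x + y) = f x + f y" "f (x - y) = f x - f y" "f (c *s x) = c *s f x" "f (- x) = - f x"
    "f 0 = 0" "f (\<Sum>i\<in>(UNIV :: 'n set). g i) = (\<Sum>i\<in>UNIV. f (g i))"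
    by (simp_all add: f.add f.diff f.scale f.neg f.sum)
qed

lemma rational_basis:
  "axis i (1::complex) \<in> lat \<rat>" "v = (\<Sum>i\<in>UNIV. (v $ i) *s axis i (1::complex))"
proof -
  show "axis i (1::complex) \<in> lat \<rat>" by (auto simp: lat_def axis_def)
  have "(\<Sum>j\<in>UNIV. v $ j * axis j 1 $ i) = (\<Sum>j\<in>UNIV. if i = j then v $ j else 0)" for i
    by (intro sum.cong) (auto simp: axis_def)
  then show "v = (\<Sum>i\<in>UNIV. (v $ i) *s axis i (1::complex))"
    by (simp add: vec_eq_iff)
qed

text \<open>
  Isometries of \<open>L\<^sub>\<rat>\<close> are represented by maps of \<open>L\<^sub>\<complex>\<close>, so identities between them need only be
  checked on rational vectors: these contain a basis.
\<close>

lemma linear_eq_on_lat_Rats: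
  fixes f g :: "complex ^ 'n \<Rightarrow> complex ^ 'n"
  assumes f: "Vector_Spaces.linear (*s) (*s) f" and g: "Vector_Spaces.linear (*s) (*s) g"
    and eq: "\<And>v. v \<in> lat \<rat> \<Longrightarrow> f v = g v"
  shows "f = g"
proof
  fix v
  have "h v = (\<Sum>i\<in>UNIV. (v $ i) *s h (axis i 1))"
    if "Vector_Spaces.linear (*s) (*s) h" for h :: "complex ^ 'n \<Rightarrow> complex ^ 'n"
    by (subst rational_basis(2)[of v]) (simp only: linear_simps[OF that])
  from this[OF f] this[OF g] show "f v = g v" by (simp add: eq rational_basis(1))
qed

lemma linear_bij_if_lat_Rats:
  fixes f :: "complex ^ 'n \<Rightarrow> complex ^ 'n"
  assumes f: "Vector_Spaces.linear (*s) (*s) f" and "lat \<rat> \<subseteq> range f"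
  shows "bij f"
proof -
  have "\<exists>x. axis i 1 = f x" for i using assms(2) rational_basis(1) by blast
  then obtain x where x: "\<And>i. axis i 1 = f (x i)" by metis
  have "v = f (\<Sum>i\<in>UNIV. (v $ i) *s x i)" for v
    by (subst rational_basis(2)[of v]) (simp only: linear_simps[OF f] x)
  then have "surj f" unfolding surj_def by blast
  then show ?thesis using vec.linear_surjective_imp_injective[OF f] by (simp add: bij_def)
qed

section \<open>Eichler transvections\<close>

lemma eichler_linear: "Vector_Spaces.linear (*s) (*s) (eichler B m l)"
  unfolding Vector_Spaces.linear_iff
  by (auto simp: eichler_def bil_simps vec_eq_iff algebra_simps vec.vector_space_axioms)

lemma eichler_zero: "eichler B 0 l = id"
proof -
  have "bil B 0 v = 0" for v by (simp add: bil_def)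
  then show ?thesis by (auto simp: eichler_def fun_eq_iff)
qed

lemma eichler_scale_right: "eichler B m (c *s l) = eichler B (c *s m) l"
  by (auto simp: eichler_def bil_simps fun_eq_iff vec_eq_iff algebra_simps)

text \<open>
  The formula for a transvection uses only the form and the vector space structure, so any
  isometry carries it along.
\<close>

lemma eichler_conj:
  assumes "Vector_Spaces.linear (*s) (*s) g" "\<And>x y. bil B (g x) (g y) = bil B x y"
  shows "g (eichler B m l v) = eichler B (g m) (g l) (g v)"
  by (simp add: eichler_def linear_simps[OF assms(1)] assms(2))

context
  fixes B :: "int ^ 'n ^ 'n" and l :: "complex ^ 'n"
  assumes sym: "transpose B = B" and iso: "bil B l l = 0"
begin

text \<open>
  Changing the lift \<open>m\<close> by a multiple of \<open>l\<close> is harmless: the correction terms cancel because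
  \<open>l\<close> is isotropic and orthogonal to \<open>m\<close>.
\<close>

lemma eichler_shift:
  assumes "bil B m l = 0" shows "eichler B (m + c *s l) l = eichler B m l"
proof -
  have "bil B l m = 0" using assms bil_commute[OF sym] by metis
  then show ?thesis using assms iso
    by (auto simp: eichler_def bil_simps fun_eq_iff vec_eq_iff algebra_simps)
qed

text \<open>
  The quadratic term of the transvection is exactly what makes \<open>m \<mapsto> E_(m \<otimes> l)\<close> additive.
\<close>

lemma eichler_comp:
  assumes "bil B m l = 0" "bil B m' l = 0"
  shows "eichler B m l \<circ> eichler B m' l = eichler B (m + m') l"
proof -
  have "bil B l m = 0" "bil B l m' = 0" "bil B m' m = bil B m m'"
    using assms bil_commute[OF sym] by metis+
  then show ?thesis using assms iso
    by (auto simp: eichler_def bil_simps fun_eq_iff vec_eq_iff field_simps)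
qed

lemma eichler_bij:
  assumes "bil B m l = 0"
  shows "bij (eichler B m l)" "inv_into UNIV (eichler B m l) = eichler B (- m) l"
proof -
  have 1: "eichler B m l \<circ> eichler B (- m) l = id" "eichler B (- m) l \<circ> eichler B m l = id"
    using eichler_comp[of m "-m"] eichler_comp[of "-m" m] assms eichler_zero
    by (auto simp: bil_simps)
  then show "bij (eichler B m l)" using o_bij by blast
  show "inv_into UNIV (eichler B m l) = eichler B (- m) l"
    using 1 inv_unique_comp by blast
qed

lemma eichler_isometry:
  assumes "bil B m l = 0"
  shows "bil B (eichler B m l x) (eichler B m l y) = bil B x y"
proof -
  have "bil B l m = 0" "bil B x m = bil B m x" "bil B y m = bil B m y"
    "bil B x l = bil B l x" "bil B y l = bil B l y"
    using assms bil_commute[OF sym] by metis+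
  then show ?thesis using assms iso
    by (simp add: eichler_def bil_simps algebra_simps)
qed

end

section \<open>Signature (2,b)\<close>

text \<open>
  Writing \<open>d\<close> for the diagonal of \<open>P\<^sup>T B P\<close> and \<open>R\<close> for the inverse of \<open>P\<close>, the form becomes a
  weighted sum of squares of the real linear coordinates given by \<open>R\<close>.
\<close>

lemma signature_diagonal_form:
  fixes B :: "int ^ 'n ^ 'n"
  assumes "has_signature B p q"
  obtains d :: "'n \<Rightarrow> real" and R :: "'n \<Rightarrow> 'n \<Rightarrow> real"
  where "card {k. d k > 0} = p"
    "\<And>x y. bil B x y = (\<Sum>k\<in>UNIV. of_real (d k) * (\<Sum>i\<in>UNIV. of_real (R k i) * x $ i)
                                        * (\<Sum>j\<in>UNIV. of_real (R k j) * y $ j))"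
proof -
  obtain P :: "real ^ 'n ^ 'n" where inv: "invertible P"
    and diag: "\<forall>i j. i \<noteq> j \<longrightarrow> (transpose P ** map_matrix real_of_int B ** P) $ i $ j = 0"
    and card: "card {i. (transpose P ** map_matrix real_of_int B ** P) $ i $ i > 0} = p"
    using assms unfolding has_signature_def Let_def by blast
  define M where "M = transpose P ** map_matrix real_of_int B ** P"
  obtain R where R: "P ** R = mat 1" using inv unfolding invertible_def by blast
  have "transpose R ** M ** R = transpose (P ** R) ** map_matrix real_of_int B ** (P ** R)"
    by (simp add: M_def matrix_transpose_mul matrix_mul_assoc)
  then have RMR: "transpose R ** M ** R = map_matrix real_of_int B"
    by (simp add: R transpose_mat)
  have B: "real_of_int (B $ i $ j) = (\<Sum>k\<in>UNIV. M $ k $ k * R $ k $ i * R $ k $ j)" for i j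
  proof -
    have "real_of_int (B $ i $ j) = (transpose R ** M ** R) $ i $ j"
      by (simp add: RMR map_matrix_def)
    also have "\<dots> = (\<Sum>k\<in>UNIV. (\<Sum>m\<in>UNIV. R $ m $ i * M $ m $ k) * R $ k $ j)"
      by (simp add: matrix_matrix_mult_def transpose_def)
    also have "\<dots> = (\<Sum>k\<in>UNIV. M $ k $ k * R $ k $ i * R $ k $ j)"
    proof (rule sum.cong)
      fix k
      have "(\<Sum>m\<in>UNIV. R $ m $ i * M $ m $ k) = (\<Sum>m\<in>UNIV. if m = k then R $ k $ i * M $ k $ k else 0)"
        using diag by (intro sum.cong) (auto simp: M_def)
      then show "(\<Sum>m\<in>UNIV. R $ m $ i * M $ m $ k) * R $ k $ j = M $ k $ k * R $ k $ i * R $ k $ j"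
        by simp
    qed simp
    finally show ?thesis .
  qed
  have "bil B x y = (\<Sum>k\<in>UNIV. of_real (M $ k $ k) * (\<Sum>i\<in>UNIV. of_real (R $ k $ i) * x $ i)
                                        * (\<Sum>j\<in>UNIV. of_real (R $ k $ j) * y $ j))" for x y
  proof -
    have cB: "(of_int (B $ i $ j) :: complex) =
        (\<Sum>k\<in>UNIV. of_real (M $ k $ k) * of_real (R $ k $ i) * of_real (R $ k $ j))" for i j
      using arg_cong[OF B[of i j], of complex_of_real] by simp
    have "bil B x y = (\<Sum>i\<in>UNIV. \<Sum>j\<in>UNIV. \<Sum>k\<in>UNIV. of_real (M $ k $ k) *
         (of_real (R $ k $ i) * x $ i) * (of_real (R $ k $ j) * y $ j))"
      unfolding bil_def cB by (simp add: sum_distrib_left sum_distrib_right mult_ac)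
    also have "\<dots> = (\<Sum>k\<in>UNIV. \<Sum>i\<in>UNIV. \<Sum>j\<in>UNIV. of_real (M $ k $ k) *
         (of_real (R $ k $ i) * x $ i) * (of_real (R $ k $ j) * y $ j))"
    proof -
      have "(\<Sum>i\<in>UNIV. \<Sum>j\<in>UNIV. \<Sum>k\<in>UNIV. f i j k) = (\<Sum>k\<in>UNIV. \<Sum>i\<in>UNIV. \<Sum>j\<in>UNIV. f i j k)"
        for f :: "'n \<Rightarrow> 'n \<Rightarrow> 'n \<Rightarrow> complex"
      proof -
        have "(\<Sum>i\<in>UNIV. \<Sum>j\<in>UNIV. \<Sum>k\<in>UNIV. f i j k) = (\<Sum>i\<in>UNIV. \<Sum>k\<in>UNIV. \<Sum>j\<in>UNIV. f i j k)"
          by (intro sum.cong refl sum.swap)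
        also have "\<dots> = (\<Sum>k\<in>UNIV. \<Sum>i\<in>UNIV. \<Sum>j\<in>UNIV. f i j k)" by (rule sum.swap)
        finally show ?thesis .
      qed
      then show ?thesis .
    qed
    also have "\<dots> = (\<Sum>k\<in>UNIV. of_real (M $ k $ k) * (\<Sum>i\<in>UNIV. of_real (R $ k $ i) * x $ i)
                                        * (\<Sum>j\<in>UNIV. of_real (R $ k $ j) * y $ j))"
      by (intro sum.cong refl) (simp add: sum_distrib_left sum_distrib_right mult_ac)
    finally show ?thesis .
  qed
  with card show thesis by (intro that[of "\<lambda>k. M $ k $ k" "\<lambda>k i. R $ k $ i"]) (auto simp: M_def)
qed

text \<open>
  The cross product of the two coefficient vectors is a solution. If it vanishes they are
  parallel, and a vector orthogonal to a nonzero one of them will do.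
\<close>

lemma two_equations_three_unknowns:
  fixes a1 a2 a3 b1 b2 b3 :: complex
  obtains x y z where "(x, y, z) \<noteq> (0, 0, 0)"
    "a1 * x + a2 * y + a3 * z = 0" "b1 * x + b2 * y + b3 * z = 0"
proof (cases "a2 * b3 = a3 * b2 \<and> a3 * b1 = a1 * b3 \<and> a1 * b2 = a2 * b1")
  case False
  show thesis
    by (rule that[of "a2 * b3 - a3 * b2" "a3 * b1 - a1 * b3" "a1 * b2 - a2 * b1"])
      (use False in \<open>auto simp: algebra_simps\<close>)
next
  case True
  consider "a1 \<noteq> 0 \<or> a2 \<noteq> 0" | "b1 \<noteq> 0 \<or> b2 \<noteq> 0" | "a1 = 0" "a2 = 0" "b1 = 0" "b2 = 0" by blast
  then show thesis
  proof cases
    case 1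
    show thesis by (rule that[of a2 "-a1" 0]) (use 1 True in \<open>auto simp: algebra_simps\<close>)
  next
    case 2
    show thesis by (rule that[of b2 "-b1" 0]) (use 2 True in \<open>auto simp: algebra_simps\<close>)
  next
    case 3
    show thesis by (rule that[of 1 0 0]) (use 3 in auto)
  qed
qed

text \<open>
  Suppose \<open>\<omega> \<bottom> l\<close>. Some nontrivial combination \<open>z\<close> of \<open>\<omega>\<close>, its conjugate and \<open>l\<close> is killed by
  the two positive coordinates, so the hermitian form is at most \<open>0\<close> at \<open>z\<close>. But on this span
  it only sees the coefficients of \<open>\<omega>\<close> and its conjugate, and there it is positive definite;
  so \<open>z\<close> is a multiple of \<open>l\<close>. The hermitian form is semidefinite on the other coordinates and
  vanishes at \<open>z\<close>, which puts \<open>z\<close>, and with it \<open>l\<close>, into the radical of the form, against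
  \<open>(w', l) \<noteq> 0\<close>.
\<close>

lemma period_not_orthogonal_to_isotropic:
  fixes B :: "int ^ 'n ^ 'n"
  assumes sym: "transpose B = B" and sig: "has_signature B 2 b"
    and l: "l \<in> lat \<real>" "bil B l l = 0" and pair: "bil B w' l \<noteq> 0"
    and om: "bil B \<omega> \<omega> = 0" "Re (bil B \<omega> (conj_vec \<omega>)) > 0"
  shows "bil B \<omega> l \<noteq> 0"
proof
  assume ol: "bil B \<omega> l = 0"
  obtain d :: "'n \<Rightarrow> real" and R where card: "card {k. d k > 0} = 2"
    and form: "\<And>x y. bil B x y = (\<Sum>k\<in>UNIV. of_real (d k) * (\<Sum>i\<in>UNIV. of_real (R k i) * x $ i)
                                        * (\<Sum>j\<in>UNIV. of_real (R k j) * y $ j))"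
    by (rule signature_diagonal_form[OF sig]) (rule that)
  define Y where "Y k x = (\<Sum>i\<in>UNIV. of_real (R k i) * x $ i)" for k and x :: "complex ^ 'n"
  have form: "bil B x y = (\<Sum>k\<in>UNIV. of_real (d k) * Y k x * Y k y)" for x y
    by (simp add: form Y_def)
  have Y_lin: "Y k (x + y) = Y k x + Y k y" "Y k (c *s x) = c * Y k x" for k c x y
    by (auto simp: Y_def algebra_simps sum.distrib sum_distrib_left)
  have Y_conj: "Y k (conj_vec x) = cnj (Y k x)" for k x
    by (simp add: Y_def conj_vec_def)
  obtain p q where pq: "{k. d k > 0} = {p, q}" using card by (auto simp: card_2_iff)
  \<comment> \<open>The two positive coordinates are \<open>p\<close> and \<open>q\<close>.\<close>
  obtain \<alpha> \<beta> \<gamma> where nz: "(\<alpha>, \<beta>, \<gamma>) \<noteq> (0, 0, 0)"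
    and eqs: "Y p \<omega> * \<alpha> + Y p (conj_vec \<omega>) * \<beta> + Y p l * \<gamma> = 0"
      "Y q \<omega> * \<alpha> + Y q (conj_vec \<omega>) * \<beta> + Y q l * \<gamma> = 0"
    by (rule two_equations_three_unknowns)
  define z where "z = \<alpha> *s \<omega> + \<beta> *s conj_vec \<omega> + \<gamma> *s l"
  have Yz: "Y p z = 0" "Y q z = 0" using eqs by (auto simp: z_def Y_lin mult_ac)
  have Ypos: "Y k z = 0" if "d k > 0" for k
  proof -
    have "k \<in> {p, q}" using that unfolding pq[symmetric] by simp
    then show ?thesis using Yz by blast
  qed
  have terms: "d k * (cmod (Y k z))\<^sup>2 \<le> 0" for k
    using Ypos[of k] by (cases "d k > 0") (auto simp: mult_nonpos_nonneg)
  have h1: "bil B z (conj_vec z) = of_real (\<Sum>k\<in>UNIV. d k * (cmod (Y k z))\<^sup>2)"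
    unfolding form Y_conj of_real_sum
    by (intro sum.cong refl) (simp only: of_real_mult complex_norm_square mult.assoc)
  have ll: "conj_vec l = l" using conj_vec_real l(1) .
  have cc: "bil B (conj_vec \<omega>) (conj_vec \<omega>) = 0" "bil B (conj_vec \<omega>) l = 0" "bil B l (conj_vec \<omega>) = 0"
    "bil B l \<omega> = 0" "bil B (conj_vec \<omega>) \<omega> = bil B \<omega> (conj_vec \<omega>)"
    using bil_conj[of B \<omega> \<omega>] bil_conj[of B \<omega> l] om ol ll bil_commute[OF sym] by auto
  have sq: "of_real ((cmod \<alpha>)\<^sup>2 + (cmod \<beta>)\<^sup>2) = \<alpha> * cnj \<alpha> + \<beta> * cnj \<beta>"
    by (simp only: of_real_add complex_norm_square)
  \<comment> \<open>Only the products of \<open>\<omega>\<close> with its conjugate survive: \<open>\<omega>\<close> is isotropic, and \<open>l\<close> is isotropic and orthogonal to both.\<close>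
  have h2: "bil B z (conj_vec z) = of_real ((cmod \<alpha>)\<^sup>2 + (cmod \<beta>)\<^sup>2) * bil B \<omega> (conj_vec \<omega>)"
    unfolding z_def conj_vec_simps ll sq
    by (simp add: bil_simps cc om ol l(2) algebra_simps)
  have eq: "((cmod \<alpha>)\<^sup>2 + (cmod \<beta>)\<^sup>2) * Re (bil B \<omega> (conj_vec \<omega>)) = (\<Sum>k\<in>UNIV. d k * (cmod (Y k z))\<^sup>2)"
    using arg_cong[OF trans[OF h2[symmetric] h1], of Re] by simp
  also have "\<dots> \<le> 0" using terms by (intro sum_nonpos)
  finally have "(cmod \<alpha>)\<^sup>2 + (cmod \<beta>)\<^sup>2 \<le> 0" using om(2) by (simp add: mult_le_0_iff)
  then have ab: "\<alpha> = 0" "\<beta> = 0"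
    by (auto simp: sum_power2_le_zero_iff)
  then have "\<gamma> \<noteq> 0" "z = \<gamma> *s l" using nz by (auto simp: z_def)
  have "(\<Sum>k\<in>UNIV. d k * (cmod (Y k z))\<^sup>2) = 0" using eq ab by simp
  then have "d k * (cmod (Y k z))\<^sup>2 = 0" for k
    using terms sum_nonneg_eq_0_iff[of UNIV "\<lambda>k. - (d k * (cmod (Y k z))\<^sup>2)"] by (simp add: sum_negf)
  then have "d k = 0 \<or> Y k l = 0" for k
    using \<open>\<gamma> \<noteq> 0\<close> \<open>z = \<gamma> *s l\<close> by (auto simp: Y_lin)
  then have "bil B w' l = 0" unfolding form by (intro sum.neutral) auto
  with pair show False by simp
qed

section \<open>Paths in the period domain\<close>

lemma topspace_quotient_top: "topspace (quotient_top X p) = p ` topspace X"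
proof
  show "topspace (quotient_top X p) \<subseteq> p ` topspace X"
    using openin_topspace[of "quotient_top X p"] unfolding openin_quotient_top by blast
  have "{x \<in> topspace X. p x \<in> p ` topspace X} = topspace X" by blast
  then have "openin (quotient_top X p) (p ` topspace X)" by (simp add: openin_quotient_top)
  then show "p ` topspace X \<subseteq> topspace (quotient_top X p)" by (rule openin_subset)
qed

lemma continuous_map_quotient_top: "continuous_map X (quotient_top X p) p"
  by (auto simp: continuous_map_def topspace_quotient_top openin_quotient_top)

lemma period_component_cases:
  assumes "D \<in> period_components B" "x \<in> D"
  obtains \<omega> where "x = line \<omega>" "bil B \<omega> \<omega> = 0" "Re (bil B \<omega> (conj_vec \<omega>)) > 0"
  using connected_components_of_subset[OF assms(1)[unfolded period_components_def]] assms(2)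
  by (auto simp: subset_iff)

text \<open>
  The component is a maximal connected set, so it swallows the image of a path of periods
  starting in it.
\<close>

lemma period_component_path:
  fixes B :: "int ^ 'n ^ 'n" and f :: "real \<Rightarrow> complex ^ 'n"
  assumes D: "D \<in> period_components B" and cont: "continuous_on UNIV f"
    and f: "\<And>t. bil B (f t) (f t) = 0" "\<And>t. Re (bil B (f t) (conj_vec (f t))) > 0"
    and 0: "line (f 0) \<in> D"
  shows "line (f t) \<in> D"
proof -
  define S where "S = {line \<omega> | \<omega>. bil B \<omega> \<omega> = 0 \<and> Re (bil B \<omega> (conj_vec \<omega>)) > 0}"
  have nz: "f t \<noteq> 0" for t using f(2)[of t] by (auto simp: bil_def)
  have "continuous_map euclideanreal (top_of_set (- {0})) f"
    using cont nz by (auto simp: continuous_map_in_subtopology)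
  then have "continuous_map euclideanreal proj_top (line \<circ> f)"
    unfolding proj_top_def by (rule continuous_map_compose) (rule continuous_map_quotient_top)
  moreover have "line (f t) \<in> S" for t using f unfolding S_def by blast
  ultimately have "continuous_map euclideanreal (subtopology proj_top S) (line \<circ> f)"
    by (auto simp: continuous_map_in_subtopology)
  from connectedin_continuous_map_image[OF this, of UNIV]
  have "connectedin (subtopology proj_top S) (range (line \<circ> f))" by simp
  moreover have "D \<in> connected_components_of (subtopology proj_top S)"
    using D unfolding period_components_def S_def .
  moreover have "\<not> disjnt D (range (line \<circ> f))"
    using 0 unfolding disjnt_iff by (metis comp_apply rangeI)
  ultimately have "range (line \<circ> f) \<subseteq> D" by (metis connected_components_of_maximal)
  then show ?thesis by auto
qed

lemma linear_image_line:
  fixes g :: "complex ^ 'n \<Rightarrow> complex ^ 'n"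
  assumes "Vector_Spaces.linear (*s) (*s) g" shows "g ` line v = line (g v)"
  by (simp add: line_def image_image linear_simps(3)[OF assms])

section \<open>The tensor cosets\<close>

lemma outer_simps: "outer (x + y) z = outer x z + outer y z" "outer (c *s x) z = outer x (c *s z)"
  "outer 0 z = 0"
  by (auto simp: outer_def vec_eq_iff algebra_simps)

text \<open>
  A rational \<open>w'\<close> with \<open>(w', l) = 1\<close> splits \<open>L\<^sub>\<rat>\<close> as \<open>I\<^sup>\<bottom> + \<rat> w'\<close>. It is the base point of the
  tube domain, and the value at \<open>w'\<close> determines the vector of a transvection.
\<close>

locale isotropic_line =
  fixes B :: "int ^ 'n ^ 'n" and I :: "(complex ^ 'n) set" and l w' :: "complex ^ 'n"
  assumes sym: "transpose B = B"
    and I_eq: "I = ext \<int> {l}" and l_int: "l \<in> lat \<int>" and iso: "bil B l l = 0"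
    and w'_rat: "w' \<in> lat \<rat>" and pair: "bil B w' l = 1"
begin

abbreviation "e m \<equiv> eichler B m l"
abbreviation "q m \<equiv> tens I m l"
abbreviation "perpQ \<equiv> perp B I \<rat>"

lemma bil_sym: "bil B x y = bil B y x" using bil_commute[OF sym] .

lemma l_nz: "l \<noteq> 0" using pair by (auto simp: bil_def)

lemma scale_l_eq: "c *s l = c' *s l \<longleftrightarrow> c = c'" using l_nz by simp

lemma mem_I: "x \<in> I \<longleftrightarrow> (\<exists>k. x = of_int k *s l)"
  by (auto simp: I_eq ext_def elim: Ints_cases)

lemma mem_ext:
  assumes "K \<in> {\<rat>, UNIV}" shows "x \<in> ext K I \<longleftrightarrow> (\<exists>c\<in>K. x = c *s l)"
proof
  assume "x \<in> ext K I"
  then obtain c k where "c \<in> K" "x = c *s (of_int k *s l)"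
    unfolding ext_def mem_I by blast
  then show "\<exists>c\<in>K. x = c *s l" using assms
    by (intro bexI[of _ "c * of_int k"]) (auto simp: vector_smult_assoc)
next
  assume "\<exists>c\<in>K. x = c *s l"
  moreover have "l \<in> I" by (subst mem_I, rule exI[of _ 1]) simp
  ultimately show "x \<in> ext K I" by (auto simp: ext_def)
qed

lemma mem_perp: "m \<in> perp B I K \<longleftrightarrow> m \<in> lat K \<and> bil B m l = 0"
proof -
  have "l \<in> I" by (subst mem_I, rule exI[of _ 1]) simp
  then have "(\<forall>x\<in>I. bil B m x = 0) \<longleftrightarrow> bil B m l = 0"
    by (auto simp: mem_I bil_simps)
  then show ?thesis by (simp add: perp_def)
qed

lemma mem_tens_II: "A \<in> tens_II I \<longleftrightarrow> (\<exists>c. A = outer (c *s l) l)"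
proof -
  have o: "outer (c *s l) (c' *s l) = outer ((c' * c) *s l) l" for c c'
    by (simp add: outer_simps(2) vector_smult_assoc mult.commute)
  show ?thesis
  proof
    assume "A \<in> tens_II I"
    then show "\<exists>c. A = outer (c *s l) l" using o by (auto simp: tens_II_def mem_ext)
  next
    assume "\<exists>c. A = outer (c *s l) l"
    then obtain c where "A = outer (c *s l) (1 *s l)" by auto
    moreover have "c *s l \<in> ext UNIV I" for c using mem_ext[of UNIV] by blast
    ultimately show "A \<in> tens_II I" unfolding tens_II_def by blast
  qed
qed

text \<open>
  As \<open>I\<close> is spanned by \<open>l\<close>, the coset of \<open>m \<otimes> l\<close> consists of the tensors \<open>(m + c l) \<otimes> l\<close>. Thus
  \<open>L(I)\<close> is handled as \<open>I\<^sup>\<bottom>\<close> modulo multiples of \<open>l\<close>.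
\<close>

lemma mem_q: "A \<in> q m \<longleftrightarrow> (\<exists>c. A = outer (m + c *s l) l)"
  unfolding tens_def set_plus_def by (auto simp: mem_tens_II outer_simps)

lemma outer_eq: "outer x l = outer y l \<longleftrightarrow> x = y"
proof
  assume "outer x l = outer y l"
  moreover obtain j where "l $ j \<noteq> 0" using l_nz by (auto simp: vec_eq_iff)
  ultimately show "x = y" by (simp add: outer_def vec_eq_iff) (metis mult_cancel_right)
qed simp

lemma q_eq: "q m = q m' \<longleftrightarrow> (\<exists>c. m - m' = c *s l)"
proof
  assume "q m = q m'"
  moreover have "outer (m + 0 *s l) l \<in> q m" unfolding mem_q by blast
  ultimately obtain c where "m + 0 *s l = m' + c *s l" by (auto simp: mem_q outer_eq)
  then show "\<exists>c. m - m' = c *s l" by (intro exI[of _ c]) simp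
next
  assume "\<exists>c. m - m' = c *s l"
  then obtain c where c: "m - m' = c *s l" ..
  have "m + a *s l = m' + (c + a) *s l" "m' + a *s l = m + (a - c) *s l" for a
    using c by (auto simp: algebra_simps vec_eq_iff)
  then show "q m = q m'" unfolding set_eq_iff mem_q by metis
qed

lemma q_add: "q m + q m' = q (m + m')"
proof -
  have "A \<in> q m + q m' \<longleftrightarrow> A \<in> q (m + m')" for A
  proof
    assume "A \<in> q m + q m'"
    then obtain a c where "A = outer (m + a *s l) l + outer (m' + c *s l) l"
      by (auto simp: set_plus_def mem_q)
    then have "A = outer (m + m' + (a + c) *s l) l"
      by (simp add: outer_simps(1)[symmetric] algebra_simps)
    then show "A \<in> q (m + m')" unfolding mem_q by blast
  next
    assume "A \<in> q (m + m')"
    then obtain a where "A = outer (m + m' + a *s l) l" by (auto simp: mem_q)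
    then have "A = outer (m + 0 *s l) l + outer (m' + a *s l) l"
      by (simp add: outer_simps(1)[symmetric] algebra_simps)
    moreover have "outer (m + 0 *s l) l \<in> q m" "outer (m' + a *s l) l \<in> q m'"
      unfolding mem_q by blast+
    ultimately show "A \<in> q m + q m'" by (metis set_plus_intro)
  qed
  then show ?thesis by blast
qed

lemma tens_II_eq: "tens_II I = q 0"
  unfolding set_eq_iff mem_q mem_tens_II by simp

lemma tens_scale: "tens I m (c *s l) = q (c *s m)"
  unfolding tens_def by (simp add: outer_simps)

lemma LI_eq: assumes "K \<in> {\<rat>, UNIV}" shows "LI B I K = q ` perp B I K"
proof -
  have "c *s m \<in> perp B I K" if "m \<in> perp B I K" "c \<in> K" for c m
    using that assms by (auto simp: mem_perp bil_simps lat_def)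
  moreover have "1 \<in> K" "l = 1 *s l" using assms by auto
  ultimately show ?thesis
    by (auto simp: LI_def mem_ext[OF assms] tens_scale image_iff) (metis vec.scale_one)+
qed

lemma transvection_q:
  assumes "bil B m l = 0" shows "transvection B I (q m) = e m"
proof -
  have "{eichler B m' l' | m' l'. m' \<in> perp B I UNIV \<and> l' \<in> ext UNIV I \<and> q m = tens I m' l'} = {e m}"
    (is "?S = _")
  proof
    show "?S \<subseteq> {e m}"
    proof
      fix f assume "f \<in> ?S"
      then obtain m' c where f: "f = eichler B m' (c *s l)" "q m = tens I m' (c *s l)"
        by (auto simp: mem_ext)
      then obtain a where "m - c *s m' = a *s l" by (auto simp: tens_scale q_eq)
      then have "c *s m' = m + (- a) *s l" by (auto simp: algebra_simps vec_eq_iff)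
      then show "f \<in> {e m}"
        using f eichler_shift[OF sym iso assms, of "- a"] by (simp add: eichler_scale_right)
    qed
    have "m \<in> perp B I UNIV" "l \<in> ext UNIV I"
      using assms by (auto simp: mem_perp mem_ext lat_def intro: exI[of _ 1])
    then show "{e m} \<subseteq> ?S" by blast
  qed
  then show ?thesis by (simp add: transvection_def)
qed

text \<open>Injectivity of \<open>w \<mapsto> E_w\<close>: the value at \<open>w'\<close> recovers \<open>m\<close> modulo \<open>l\<close>.\<close>

lemma e_eq_iff:
  assumes "bil B m l = 0" "bil B m' l = 0" shows "e m = e m' \<longleftrightarrow> q m = q m'"
proof
  assume "e m = e m'"
  then have "e m w' = e m' w'" by simp
  then have "m - m' = (bil B m w' + 1/2 * bil B m m - (bil B m' w' + 1/2 * bil B m' m')) *s l"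
    using pair bil_sym[of l w'] by (simp add: eichler_def vec_eq_iff algebra_simps)
  then show "q m = q m'" unfolding q_eq by blast
qed (use transvection_q assms in metis)

end

section \<open>The orthogonal groups as groups of permutations\<close>

lemma linear_comp_vec:
  fixes f g :: "complex ^ 'n \<Rightarrow> complex ^ 'n"
  assumes "Vector_Spaces.linear (*s) (*s) f" "Vector_Spaces.linear (*s) (*s) g"
  shows "Vector_Spaces.linear (*s) (*s) (f \<circ> g)"
  unfolding Vector_Spaces.linear_iff
  by (simp add: vec.vector_space_axioms linear_simps[OF assms(1)] linear_simps[OF assms(2)])

lemma linear_inv_vec:
  fixes f :: "complex ^ 'n \<Rightarrow> complex ^ 'n"
  assumes f: "Vector_Spaces.linear (*s) (*s) f" and "bij f"
  shows "Vector_Spaces.linear (*s) (*s) (inv_into UNIV f)"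
proof -
  have r: "f (inv_into UNIV f x) = x" "inv_into UNIV f (f x) = x" for x
    using assms(2) by (simp_all add: bij_is_surj surj_f_inv_f bij_is_inj)
  have "inv_into UNIV f (x + y) = inv_into UNIV f x + inv_into UNIV f y" for x y
    using linear_simps(1)[OF f, of "inv_into UNIV f x" "inv_into UNIV f y"] r by metis
  moreover have "inv_into UNIV f (c *s x) = c *s inv_into UNIV f x" for c x
    using linear_simps(3)[OF f, of c "inv_into UNIV f x"] r by metis
  ultimately show ?thesis
    unfolding Vector_Spaces.linear_iff by (simp add: vec.vector_space_axioms)
qed

lemma linear_uminus: "Vector_Spaces.linear (*s) (*s) (uminus :: complex ^ 'n \<Rightarrow> complex ^ 'n)"
  unfolding Vector_Spaces.linear_iff by (simp add: vec.vector_space_axioms)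

text \<open>
  Bijectivity on \<open>L\<^sub>\<complex>\<close> follows from that on \<open>L\<^sub>\<rat>\<close>: the image contains a basis, and in finite
  dimension surjective linear maps are injective.
\<close>

lemma orth_Q_D:
  assumes "g \<in> orth_Q B"
  shows "Vector_Spaces.linear (*s) (*s) g" "bil B (g x) (g y) = bil B x y" "bij g" "g ` lat \<rat> = lat \<rat>"
proof -
  show g: "Vector_Spaces.linear (*s) (*s) g" "bil B (g x) (g y) = bil B x y" "g ` lat \<rat> = lat \<rat>"
    using assms by (auto simp: orth_Q_def)
  then show "bij g" using linear_bij_if_lat_Rats[of g] by (metis image_mono subset_UNIV)
qed

lemma image_comp_eq: "g ` A = A \<Longrightarrow> h ` A = A \<Longrightarrow> (g \<circ> h) ` A = A"
  by (simp only: image_comp[symmetric])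

lemma image_inv_eq: "bij g \<Longrightarrow> g ` A = A \<Longrightarrow> inv_into UNIV g ` A = A"
  by (metis bij_is_inj image_inv_f_f)

lemma perm_group_restrict:
  assumes "perm_group S"
    and "P id" "\<And>g h. g \<in> S \<Longrightarrow> h \<in> S \<Longrightarrow> P g \<Longrightarrow> P h \<Longrightarrow> P (g \<circ> h)"
    and "\<And>g. g \<in> S \<Longrightarrow> bij g \<Longrightarrow> P g \<Longrightarrow> P (inv_into UNIV g)"
  shows "perm_group {g \<in> S. P g}"
  using assms by (simp add: perm_group_def)

lemma perm_group_orth_Q: "perm_group (orth_Q B)"
proof -
  have "inv_into UNIV g \<in> orth_Q B" if g: "g \<in> orth_Q B" for g
  proof -
    note * = orth_Q_D[OF g]
    have r: "g (inv_into UNIV g x) = x" for x using *(3) by (simp add: bij_is_surj surj_f_inv_f)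
    have "bil B (inv_into UNIV g x) (inv_into UNIV g y) = bil B x y" for x y
      using *(2)[of "inv_into UNIV g x" "inv_into UNIV g y"] r by simp
    then show ?thesis
      using linear_inv_vec[OF *(1,3)] image_inv_eq[OF *(3,4)] by (simp add: orth_Q_def)
  qed
  moreover have "g \<circ> h \<in> orth_Q B" if g: "g \<in> orth_Q B" and h: "h \<in> orth_Q B" for g h
    using linear_comp_vec[OF orth_Q_D(1)[OF g] orth_Q_D(1)[OF h]] orth_Q_D[OF g] orth_Q_D[OF h]
    by (simp add: orth_Q_def image_comp_eq del: comp_apply) simp
  moreover have "id \<in> orth_Q B"
    by (simp add: orth_Q_def id_def Vector_Spaces.linear_iff vec.vector_space_axioms)
  ultimately show ?thesis using orth_Q_D(3) by (auto simp: perm_group_def)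
qed

lemma perm_group_Oplus_Q:
  fixes B :: "int ^ 'n ^ 'n"
  shows "perm_group (Oplus_Q B D)"
  unfolding Oplus_Q_def
proof (rule perm_group_restrict[OF perm_group_orth_Q])
  fix g h :: "complex ^ 'n \<Rightarrow> complex ^ 'n"
  assume *: "(`) g ` D = D" "(`) h ` D = D"
  have "(`) (g \<circ> h) ` D = (`) g ` (`) h ` D" by (simp add: image_comp comp_def image_image)
  then show "(`) (g \<circ> h) ` D = D" using * by simp
next
  fix g :: "complex ^ 'n \<Rightarrow> complex ^ 'n"
  assume *: "bij g" "(`) g ` D = D"
  have "(`) (inv_into UNIV g) ` (`) g ` D = D"
    using *(1) by (simp add: image_image bij_is_inj)
  then show "(`) (inv_into UNIV g) ` D = D" using * by simp
qed simp

lemma perm_group_Oplus: "perm_group (Oplus B D)"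
  unfolding Oplus_def
  by (rule perm_group_restrict[OF perm_group_Oplus_Q])
    (simp, (rule image_comp_eq image_inv_eq; assumption)+)

lemma perm_group_GammaI_Q: "perm_group (GammaI_Q B D I)"
  unfolding GammaI_Q_def
  by (rule perm_group_restrict[OF perm_group_Oplus_Q])
    (simp, (rule image_comp_eq image_inv_eq; assumption)+)

lemma uminus_line: "uminus ` line v = line v"
proof -
  have "uminus ` line v = line (- v)" by (rule linear_image_line[OF linear_uminus])
  also have "\<dots> = line v"
  proof -
    have "c *s (- v) = (- c) *s v" "c *s v = (- c) *s (- v)" for c by (auto simp: vec_eq_iff)
    then show ?thesis unfolding line_def by (metis (no_types) rangeI image_subsetI subset_antisym)
  qed
  finally show ?thesis .
qed

lemma uminus_Oplus_Q:
  assumes "D \<in> period_components B" shows "uminus \<in> Oplus_Q B D"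
proof -
  have "uminus ` x = x" if "x \<in> D" for x
    using period_component_cases[OF assms that] uminus_line by metis
  then have "(`) uminus ` D = D" by simp
  moreover have "uminus ` lat \<rat> = (lat \<rat> :: (complex ^ 'n) set)"
  proof -
    have "x \<in> uminus ` lat \<rat>" if "x \<in> lat \<rat>" for x :: "complex ^ 'n"
      using that lat_Rats_closed(5)[OF that] by (metis image_eqI minus_minus)
    then show ?thesis using lat_Rats_closed(5) by blast
  qed
  ultimately show ?thesis
    using linear_uminus by (simp add: Oplus_Q_def orth_Q_def bil_simps)
qed

section \<open>The unipotent radical\<close>

locale cusp = isotropic_line B I l w'
  for B :: "int ^ 'n ^ 'n" and I :: "(complex ^ 'n) set" and l w' :: "complex ^ 'n" +
  fixes D :: "(complex ^ 'n) set set" and \<Gamma> :: "(complex ^ 'n \<Rightarrow> complex ^ 'n) set" and b :: nat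
  assumes sig: "has_signature B 2 b" and D: "D \<in> period_components B"
    and fin: "finite_index_subgroup \<Gamma> (comp_group (Oplus B D))"
begin

abbreviation "GQ \<equiv> GammaI_Q B D I"
abbreviation "UQ \<equiv> UI_Q B D I"
abbreviation "GZ \<equiv> GammaI_Z B D \<Gamma> I"
abbreviation "UZ \<equiv> UI_Z B D \<Gamma> I"

lemma perm_group_Gamma: "perm_group \<Gamma>"
  using fin subgroup_perm_group[OF perm_group_Oplus] by (auto simp: finite_index_subgroup_def)

lemma Gamma_Oplus: "\<Gamma> \<subseteq> Oplus B D"
  using fin subgroup.subset[of \<Gamma> "comp_group (Oplus B D)"] by (simp add: finite_index_subgroup_def)

lemma Gamma_Oplus_Q: "\<Gamma> \<subseteq> Oplus_Q B D"
  using Gamma_Oplus by (auto simp: Oplus_def)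

lemma GQ_D:
  assumes "g \<in> GQ"
  shows "Vector_Spaces.linear (*s) (*s) g" "bil B (g x) (g y) = bil B x y" "bij g"
    "v \<in> lat \<rat> \<Longrightarrow> g v \<in> lat \<rat>" "g ` I = I" "X \<in> D \<Longrightarrow> g ` X \<in> D"
  using assms orth_Q_D[of g B] by (auto simp: GammaI_Q_def Oplus_Q_def)

text \<open>An automorphism of \<open>I \<simeq> \<int>\<close> is multiplication by a unit of \<open>\<int>\<close>.\<close>

lemma GQ_sign:
  assumes "g \<in> GQ"
  obtains \<epsilon> where "\<epsilon> = 1 \<or> \<epsilon> = -1" "g l = \<epsilon> *s l"
proof -
  have lI: "l \<in> I" by (subst mem_I, rule exI[of _ 1]) simp
  obtain k where k: "g l = of_int k *s l" using GQ_D(5)[OF assms] lI mem_I by blast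
  obtain x where "l = g x" "x \<in> I" using GQ_D(5)[OF assms] lI by blast
  then obtain j where "l = of_int j *s g l"
    using mem_I linear_simps(3)[OF GQ_D(1)[OF assms]] by metis
  then have "(of_int (j * k) :: complex) *s l = 1 *s l" by (simp add: k vector_smult_assoc)
  then have "(of_int (j * k) :: complex) = of_int 1" unfolding scale_l_eq by simp
  then have "j * k = 1" by (simp only: of_int_eq_iff)
  then have "k = 1 \<or> k = -1" by (simp add: zmult_eq_1_iff) blast
  then show thesis using that[of "of_int k"] k by auto
qed

lemma perpQ_closed:
  "m \<in> perpQ \<Longrightarrow> m' \<in> perpQ \<Longrightarrow> m + m' \<in> perpQ" "m \<in> perpQ \<Longrightarrow> m' \<in> perpQ \<Longrightarrow> m - m' \<in> perpQ"
  "m \<in> perpQ \<Longrightarrow> c \<in> \<rat> \<Longrightarrow> c *s m \<in> perpQ" "m \<in> perpQ \<Longrightarrow> - m \<in> perpQ" "0 \<in> perpQ"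
  by (auto simp: mem_perp bil_simps lat_Rats_closed) (simp add: bil_def)

lemma perpQ_bil: "m \<in> perpQ \<Longrightarrow> bil B m l = 0" by (simp add: mem_perp)

lemma GQ_perpQ:
  assumes "g \<in> GQ" "m \<in> perpQ" shows "g m \<in> perpQ"
proof -
  obtain \<epsilon> where \<epsilon>: "\<epsilon> = 1 \<or> \<epsilon> = -1" "g l = \<epsilon> *s l" using GQ_sign[OF assms(1)] .
  have "\<epsilon> * bil B (g m) l = bil B m l"
    using GQ_D(2)[OF assms(1), of m l] \<epsilon>(2) by (simp add: bil_simps)
  then show ?thesis using \<epsilon>(1) assms GQ_D(4) by (auto simp: mem_perp)
qed

text \<open>
  The path \<open>t \<mapsto> e (t m) \<omega>\<close> stays among the periods, because a real transvection is an isometry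
  that commutes with complex conjugation. Real and not only rational \<open>m\<close> is essential for the
  analysis of translations below.
\<close>

lemma real_transvection_D:
  assumes m: "m \<in> lat \<real>" "bil B m l = 0" and x: "x \<in> D"
  shows "e m ` x \<in> D"
proof -
  obtain \<omega> where \<omega>: "x = line \<omega>" "bil B \<omega> \<omega> = 0" "Re (bil B \<omega> (conj_vec \<omega>)) > 0"
    using period_component_cases[OF D x] .
  define f where "f t = e (complex_of_real t *s m) \<omega>" for t
  have lR: "conj_vec l = l" using conj_vec_real[OF lat_Rats_Reals[OF lat_Ints_Rats[OF l_int]]] .
  have tm: "bil B (complex_of_real t *s m) l = 0" for t using m by (simp add: bil_simps)
  have cj: "conj_vec (f t) = e (complex_of_real t *s m) (conj_vec \<omega>)" for t
  proof -
    have "conj_vec (e M \<omega>) = e M (conj_vec \<omega>)" if "conj_vec M = M" for M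
      unfolding eichler_def conj_vec_simps lR that by (simp add: bil_conj[symmetric] lR that)
    moreover have "conj_vec (complex_of_real t *s m) = complex_of_real t *s m"
      using conj_vec_real[OF m(1)] by (simp add: conj_vec_simps)
    ultimately show ?thesis unfolding f_def by blast
  qed
  \<comment> \<open>Coordinates make the continuity of the path visible.\<close>
  have f_eq: "f = (\<lambda>t. \<chi> i. \<omega> $ i - of_real t * bil B m \<omega> * l $ i + bil B l \<omega> * (of_real t * m $ i)
      - 1 / 2 * (of_real t * (of_real t * bil B m m)) * bil B l \<omega> * l $ i)"
    by (simp add: fun_eq_iff vec_eq_iff f_def eichler_def bil_simps)
  have "line (f 1) \<in> D"
  proof (rule period_component_path[OF D])
    show "continuous_on UNIV f"
      unfolding f_eq by (intro continuous_on_vec_lambda continuous_intros)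
    show "bil B (f t) (f t) = 0" "Re (bil B (f t) (conj_vec (f t))) > 0" for t
      unfolding cj unfolding f_def eichler_isometry[OF sym iso tm] by fact+
    show "line (f 0) \<in> D"
      using x \<omega>(1) by (simp add: f_def eichler_zero)
  qed
  then show ?thesis
    by (simp add: \<omega>(1) linear_image_line[OF eichler_linear] f_def)
qed

lemma e_lat_Rats: "m \<in> perpQ \<Longrightarrow> v \<in> lat \<rat> \<Longrightarrow> e m v \<in> lat \<rat>"
  using lat_Ints_Rats[OF l_int] unfolding eichler_def mem_perp
  by (auto intro!: lat_Rats_closed bil_Rats Rats_mult Rats_divide)

lemma e_image_eq:
  assumes "bil B m l = 0" "\<And>x. x \<in> A \<Longrightarrow> e m x \<in> A" "\<And>x. x \<in> A \<Longrightarrow> e (- m) x \<in> A"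
  shows "e m ` A = A"
proof -
  have "e m (e (- m) x) = x" for x
    using eichler_comp[OF sym iso assms(1), of "- m"] assms(1)
    by (simp add: bil_simps fun_eq_iff eichler_zero)
  then show ?thesis using assms(2,3) by (metis image_eqI image_subsetI subsetI subset_antisym)
qed

lemma e_fixes_l: "bil B m l = 0 \<Longrightarrow> e m l = l"
  by (simp add: eichler_def iso)

lemma e_Oplus_Q:
  assumes m: "m \<in> perpQ" shows "e m \<in> Oplus_Q B D"
proof -
  have real: "m' \<in> lat \<real>" "bil B m' l = 0" if "m' \<in> perpQ" for m'
    using that lat_Rats_Reals by (auto simp: mem_perp)
  have "e m ` lat \<rat> = lat \<rat>"
    using e_image_eq[OF perpQ_bil[OF m]] e_lat_Rats m perpQ_closed(4) by metis
  then have "e m \<in> orth_Q B"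
    using eichler_linear eichler_isometry[OF sym iso perpQ_bil[OF m]] by (auto simp: orth_Q_def)
  moreover have "(`) (e m) ` D = D"
  proof -
    have "e m ` e (- m) ` x = x" for x
      using eichler_comp[OF sym iso, of m "- m"] perpQ_bil[OF m]
      by (simp add: bil_simps image_comp eichler_zero)
    moreover have "e (- m) ` x \<in> D" "e m ` x \<in> D" if "x \<in> D" for x
      using real_transvection_D real m perpQ_closed(4)[OF m] that by metis+
    ultimately show ?thesis by (metis image_eqI image_subsetI subsetI subset_antisym)
  qed
  ultimately show ?thesis by (simp add: Oplus_Q_def)
qed

lemma e_GQ:
  assumes m: "m \<in> perpQ" shows "e m \<in> GQ"
proof -
  have "e m x = x" if "x \<in> I" for x
    using that e_fixes_l[OF perpQ_bil[OF m]] by (auto simp: mem_I linear_simps[OF eichler_linear])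
  then have "e m ` I = I" by simp
  then show ?thesis using e_Oplus_Q[OF m] by (simp add: GammaI_Q_def)
qed

lemma uminus_GQ: "uminus \<in> GQ"
proof -
  have "- x \<in> I" if "x \<in> I" for x
  proof -
    from that obtain k where "x = of_int k *s l" unfolding mem_I ..
    then have "- x = of_int (- k) *s l" by (simp add: vec_eq_iff)
    then show ?thesis unfolding mem_I ..
  qed
  then have "x \<in> uminus ` I" if "x \<in> I" for x using that by (intro image_eqI[of _ _ "- x"]) auto
  with \<open>\<And>x. x \<in> I \<Longrightarrow> - x \<in> I\<close> have "uminus ` I = I" by blast
  then show ?thesis using uminus_Oplus_Q[OF D] by (simp add: GammaI_Q_def)
qed

lemma rational_multiple_of_l:
  assumes "c *s l \<in> lat \<rat>" shows "c \<in> \<rat>"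
proof -
  obtain j where j: "l $ j \<noteq> 0" using l_nz by (auto simp: vec_eq_iff)
  have "c * l $ j \<in> \<rat>" "l $ j \<in> \<rat>" using assms lat_Ints_Rats[OF l_int] by (auto simp: lat_def)
  then have "c * l $ j / l $ j \<in> \<rat>" by (rule Rats_divide)
  then show ?thesis using j by simp
qed

lemma e_UQ:
  assumes m: "m \<in> perpQ" shows "e m \<in> UQ"
proof -
  have "e m x = x" if "x \<in> I" for x
    using that e_fixes_l[OF perpQ_bil[OF m]] by (auto simp: mem_I linear_simps[OF eichler_linear])
  moreover have "e m v - v \<in> ext \<rat> I" if v: "v \<in> perpQ" for v
  proof -
    have "bil B l v = 0" "- bil B m v \<in> \<rat>"
      using v m bil_sym bil_Rats by (auto simp: mem_perp)
    moreover have "e m v - v = (- bil B m v) *s l"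
      using calculation by (simp add: eichler_def vec_eq_iff)
    ultimately show ?thesis using mem_ext[of \<rat>] by blast
  qed
  ultimately show ?thesis using e_GQ[OF m] by (simp add: UI_Q_def)
qed

text \<open>
  On \<open>v \<in> I\<^sup>\<bottom>\<close> the map is \<open>v + c l\<close>, and pairing with \<open>g w' = w' + u\<close> gives \<open>c = - (u, v)\<close>. At
  \<open>w'\<close> itself, \<open>(g w', g w') = (w', w')\<close> gives \<open>(u, w') = - (u, u) / 2\<close>. These are the values
  of \<open>e u\<close>.
\<close>

lemma UQ_imp_transvection:
  assumes g: "g \<in> UQ"
  obtains m where "m \<in> perpQ" "g = e m"
proof -
  have gQ: "g \<in> GQ" using g by (simp add: UI_Q_def)
  note lin = linear_simps[OF GQ_D(1)[OF gQ]]
  have lI: "l \<in> I" by (subst mem_I, rule exI[of _ 1]) simp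
  have gl: "g l = l" using g lI by (simp add: UI_Q_def)
  define u where "u = g w' - w'"
  have gw: "g w' = w' + u" by (simp add: u_def)
  have "bil B (g w') (g l) = bil B w' l" by (rule GQ_D(2)[OF gQ])
  then have ul: "bil B u l = 0" by (simp add: gl gw bil_simps)
  have uQ: "u \<in> perpQ"
    using ul lat_Rats_closed(3)[OF GQ_D(4)[OF gQ w'_rat] w'_rat] by (simp add: mem_perp u_def)
  have on_perp: "g v = e u v" if v: "v \<in> perpQ" for v
  proof -
    have "g v - v \<in> ext \<rat> I" using g v by (simp add: UI_Q_def)
    then obtain c where "g v - v = c *s l" using mem_ext[of \<rat>] by auto
    then have gv: "g v = v + c *s l" by (metis add.commute diff_add_cancel)
    have "bil B (g v) (g w') = bil B v w'" by (rule GQ_D(2)[OF gQ])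
    then have "c = - bil B u v"
      using perpQ_bil[OF v] ul pair bil_sym[of l] bil_sym[of v u]
      by (simp add: gv gw bil_simps algebra_simps eq_neg_iff_add_eq_0)
    then show ?thesis using gv perpQ_bil[OF v] bil_sym[of l v] by (simp add: eichler_def vec_eq_iff)
  qed
  have on_w': "g w' = e u w'"
  proof -
    have "bil B (g w') (g w') = bil B w' w'" by (rule GQ_D(2)[OF gQ])
    then have "bil B u w' = - (1/2 * bil B u u)"
      using bil_sym[of w' u] by (simp add: gw bil_simps field_simps add_eq_0_iff)
    then show ?thesis using pair bil_sym[of l w'] by (simp add: eichler_def gw vec_eq_iff)
  qed
  have "g = e u"
  proof (rule linear_eq_on_lat_Rats[OF GQ_D(1)[OF gQ] eichler_linear])
    fix v :: "complex ^ 'n" assume v: "v \<in> lat \<rat>"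
    \<comment> \<open>Decompose \<open>v\<close> along \<open>L\<^sub>\<rat> = I\<^sup>\<bottom> + \<rat> w'\<close>.\<close>
    define v0 where "v0 = v - bil B v l *s w'"
    have "v0 \<in> perpQ"
      using v w'_rat bil_Rats[OF v lat_Ints_Rats[OF l_int]] pair
      by (auto simp: v0_def mem_perp bil_simps intro!: lat_Rats_closed)
    moreover have "v = v0 + bil B v l *s w'" by (simp add: v0_def)
    ultimately show "g v = e u v"
      using on_perp on_w' lin(1,3) linear_simps(1,3)[OF eichler_linear] by metis
  qed
  with uQ show thesis using that by blast
qed

lemma UQ_eq: "UQ = e ` perpQ"
  using e_UQ UQ_imp_transvection by blast

text \<open>
  The hypothesis says that \<open>g m \<otimes> g l\<close> and \<open>m \<otimes> l\<close> have the same class in \<open>L(I)\<close> for all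
  rational \<open>m\<close>. Then \<open>\<epsilon> g\<close> fixes \<open>l\<close> and acts trivially on \<open>I\<^sup>\<bottom> / I\<close>, so that it is a
  transvection.
\<close>

lemma sign_twist_unipotent:
  assumes g: "g \<in> GQ" and \<epsilon>: "\<epsilon> = 1 \<or> \<epsilon> = -1" "g l = \<epsilon> *s l"
    and triv: "\<And>m. m \<in> perpQ \<Longrightarrow> \<exists>c. \<epsilon> *s g m - m = c *s l"
  shows "\<exists>m\<in>perpQ. g = e m \<or> g = uminus \<circ> e m"
proof -
  have *: "k \<in> UQ" if k: "k \<in> GQ" "k l = l" "\<And>m. m \<in> perpQ \<Longrightarrow> \<exists>c. k m - m = c *s l" for k
  proof -
    have "k x = x" if "x \<in> I" for x
      using that k(2) by (auto simp: mem_I linear_simps[OF GQ_D(1)[OF k(1)]])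
    moreover have "k m - m \<in> ext \<rat> I" if m: "m \<in> perpQ" for m
    proof -
      obtain c where c: "k m - m = c *s l" using k(3)[OF m] ..
      moreover have "k m - m \<in> lat \<rat>" using perpQ_closed(2)[OF GQ_perpQ[OF k(1) m] m] by (simp add: mem_perp)
      ultimately show ?thesis using rational_multiple_of_l mem_ext[of \<rat>] by auto
    qed
    ultimately show ?thesis using k(1) by (simp add: UI_Q_def)
  qed
  from \<epsilon>(1) show ?thesis
  proof
    assume "\<epsilon> = 1"
    then have "g \<in> UQ" using * g \<epsilon> triv by simp
    then show ?thesis using UQ_imp_transvection by metis
  next
    assume e: "\<epsilon> = -1"
    have "uminus \<circ> g \<in> GQ"
      using perm_group_GammaI_Q[of B D I] uminus_GQ g by (auto simp: perm_group_def)
    moreover have "(uminus \<circ> g) l = l" using \<epsilon>(2) e by (simp add: vec_eq_iff)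
    moreover have "\<exists>c. (uminus \<circ> g) m - m = c *s l" if "m \<in> perpQ" for m
      using triv[OF that] e by (simp add: vec_eq_iff)
    ultimately have "uminus \<circ> g \<in> UQ" by (rule *)
    then obtain m where m: "m \<in> perpQ" "uminus \<circ> g = e m" using UQ_imp_transvection by metis
    then have "g = uminus \<circ> e m" by (simp add: fun_eq_iff) (metis minus_minus)
    then show ?thesis using m(1) by blast
  qed
qed

lemma conj_transvection:
  assumes "g \<in> GQ" "m \<in> perpQ" "g l = \<epsilon> *s l"
  shows "g \<circ> e m \<circ> inv_into UNIV g = e (\<epsilon> *s g m)"
proof
  fix v
  have r: "g (inv_into UNIV g v) = v" using GQ_D(3)[OF assms(1)] by (simp add: bij_is_surj surj_f_inv_f)
  show "(g \<circ> e m \<circ> inv_into UNIV g) v = e (\<epsilon> *s g m) v"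
    using eichler_conj[OF GQ_D(1,2)[OF assms(1)], of m l "inv_into UNIV g v"] assms(3) r
    by (simp add: eichler_scale_right)
qed

section \<open>Commensurability\<close>

text \<open>Doubling an integral vector absorbs the factor \<open>1/2\<close> in the quadratic term.\<close>

lemma double_integral_transvection:
  assumes m: "m \<in> lat \<int>" "bil B m l = 0" shows "e (2 *s m) \<in> Oplus B D"
proof -
  have closed: "e (2 *s m') v \<in> lat \<int>" if m': "m' \<in> lat \<int>" and v: "v \<in> lat \<int>" for m' v
  proof -
    have "1 / 2 * bil B (2 *s m') (2 *s m') * bil B l v = 2 * bil B m' m' * bil B l v"
      by (simp add: bil_simps)
    then show ?thesis
      using m' v l_int unfolding eichler_def
      by (auto intro!: lat_Ints_closed Ints_mult bil_Ints simp: bil_simps)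
  qed
  have "2 *s m \<in> perpQ" using m lat_Ints_Rats[OF m(1)]
    by (auto simp: mem_perp bil_simps intro!: lat_Rats_closed)
  then have "e (2 *s m) \<in> Oplus_Q B D" by (rule e_Oplus_Q)
  moreover have "e (2 *s m) ` lat \<int> = lat \<int>"
  proof (rule e_image_eq)
    have "- (2 *s m) = 2 *s ((- 1) *s m)" by (simp add: vec_eq_iff)
    moreover have "(- 1) *s m \<in> lat \<int>" by (rule lat_Ints_closed) (use m in auto)
    ultimately show "e (- (2 *s m)) x \<in> lat \<int>" if "x \<in> lat \<int>" for x
      using closed that by metis
  qed (use closed m in \<open>auto simp: bil_simps\<close>)
  ultimately show ?thesis by (simp add: Oplus_def)
qed

text \<open>
  This is the statement that \<open>U(I)\<^sub>\<int>\<close> spans \<open>U(I)\<^sub>\<rat>\<close>. The transvections of the multiples of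
  \<open>2 d m\<close>, with \<open>d\<close> a denominator of \<open>m\<close>, preserve \<open>L\<close>; as there are finitely many cosets of
  \<open>\<Gamma>\<close>, two of them lie in the same coset, and their quotient is the one sought.
\<close>

lemma multiple_in_Gamma:
  assumes m: "m \<in> perpQ"
  obtains N :: nat where "N > 0" "e (of_nat N *s m) \<in> \<Gamma>"
proof -
  obtain d :: nat where d: "d > 0" "of_nat d *s m \<in> lat \<int>"
    using rational_vector_clear_denominators m by (auto simp: mem_perp)
  \<comment> \<open>The factor \<open>2 d\<close> makes all these vectors twice an integral vector.\<close>
  define a where "a j = (of_nat (2 * j * d) :: complex) *s m" for j
  have a: "e (a j) \<in> Oplus B D" for j
  proof -
    have "a j = 2 *s (of_nat j *s (of_nat d *s m))" by (simp add: a_def vec_eq_iff)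
    moreover have "of_nat j *s (of_nat d *s m) \<in> lat \<int>" by (rule lat_Ints_closed) (use d in auto)
    moreover have "bil B (of_nat j *s (of_nat d *s m)) l = 0" using m by (simp add: bil_simps mem_perp)
    ultimately show ?thesis using double_integral_transvection by metis
  qed
  define C where "C j = \<Gamma> #>\<^bsub>comp_group (Oplus B D)\<^esub> e (a j)" for j
  have "range C \<subseteq> rcosets\<^bsub>comp_group (Oplus B D)\<^esub> \<Gamma>"
    using a by (auto simp: RCOSETS_def C_def)
  then have "finite (range C)" using fin finite_subset by (auto simp: finite_index_subgroup_def)
  then have "\<not> inj C" using finite_imageD by blast
  then obtain i j where ij: "C i = C j" "i < j" unfolding inj_def by (metis linorder_neqE_nat)
  have "e (a j) \<circ> inv_into UNIV (e (a i)) \<in> \<Gamma>"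
    using comp_group_coset_eq_iff[OF perm_group_Oplus perm_group_Gamma Gamma_Oplus a a] ij(1)
    unfolding C_def by metis
  moreover have al: "bil B (a k) l = 0" "bil B (- a k) l = 0" for k
    using m by (auto simp: a_def bil_simps mem_perp)
  moreover have "a j + - a i = of_nat (2 * (j - i) * d) *s m"
    using ij(2) by (simp add: a_def vec_eq_iff of_nat_diff algebra_simps)
  ultimately have "e (of_nat (2 * (j - i) * d) *s m) \<in> \<Gamma>"
    using eichler_bij(2)[OF sym iso al(1)[of i]] eichler_comp[OF sym iso al(1)[of j] al(2)[of i]] by simp
  then show thesis using that[of "2 * (j - i) * d"] d ij(2) by simp
qed

section \<open>The integral groups\<close>

abbreviation "\<Lambda> \<equiv> UI_lattice B D \<Gamma> I"
abbreviation "neg_e m \<equiv> uminus \<circ> e m"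

lemma e_comp: "m \<in> perpQ \<Longrightarrow> m' \<in> perpQ \<Longrightarrow> e m \<circ> e m' = e (m + m')"
  using eichler_comp[OF sym iso] perpQ_bil by blast

lemma e_inv: "m \<in> perpQ \<Longrightarrow> inv_into UNIV (e m) = e (- m)"
  using eichler_bij[OF sym iso] perpQ_bil by blast

lemma e_zero: "e 0 = id" by (rule eichler_zero)

lemma perm_group_UQ: "perm_group UQ"
proof -
  have "id \<in> e ` perpQ" using e_zero perpQ_closed(5) by (metis image_eqI)
  moreover have "bij (e m)" if "m \<in> perpQ" for m
    using eichler_bij(1)[OF sym iso] perpQ_bil[OF that] by blast
  ultimately show ?thesis
    unfolding perm_group_def UQ_eq by (auto simp: e_comp e_inv perpQ_closed)
qed

lemma UQ_GQ: "UQ \<subseteq> GQ" by (auto simp: UI_Q_def)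

lemma UZ_eq: "UZ = e ` {m \<in> perpQ. e m \<in> \<Gamma>}"
  by (auto simp: UI_Z_def UQ_eq)

lemma e_UZ_iff: "m \<in> perpQ \<Longrightarrow> e m \<in> UZ \<longleftrightarrow> e m \<in> \<Gamma>"
  using e_UQ by (auto simp: UI_Z_def)

lemma perm_group_UZ: "perm_group UZ" and perm_group_GZ: "perm_group GZ"
  unfolding UI_Z_def GammaI_Z_def
  using perm_group_Int perm_group_UQ perm_group_Gamma perm_group_GammaI_Q by blast+

lemma UZ_GZ: "UZ \<subseteq> GZ" and GZ_GQ: "GZ \<subseteq> GQ" and GZ_Gamma: "GZ \<subseteq> \<Gamma>"
  using UQ_GQ by (auto simp: UI_Z_def GammaI_Z_def)

lemma neg_e_GQ: "m \<in> perpQ \<Longrightarrow> neg_e m \<in> GQ"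
  using perm_group_GammaI_Q[of B D I] uminus_GQ e_GQ[of m] unfolding perm_group_def by blast

lemma neg_e_GZ_iff: "m \<in> perpQ \<Longrightarrow> neg_e m \<in> GZ \<longleftrightarrow> neg_e m \<in> \<Gamma>"
  using neg_e_GQ by (auto simp: GammaI_Z_def)

lemma Gamma_comp: "g \<in> \<Gamma> \<Longrightarrow> h \<in> \<Gamma> \<Longrightarrow> g \<circ> h \<in> \<Gamma>"
  and Gamma_inv: "g \<in> \<Gamma> \<Longrightarrow> inv_into UNIV g \<in> \<Gamma>"
  using perm_group_Gamma by (auto simp: perm_group_def)

lemma e_minus: "e m (- v) = - e m v" by (rule linear_simps(4)[OF eichler_linear])

lemma neg_e_comp:
  assumes "m \<in> perpQ" "m' \<in> perpQ"
  shows "neg_e m \<circ> neg_e m' = e (m + m')" "e m \<circ> neg_e m' = neg_e (m + m')" "neg_e m \<circ> e m' = neg_e (m + m')"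
  using e_comp[OF assms] by (auto simp: fun_eq_iff e_minus)

lemma neg_e_inv:
  assumes "m \<in> perpQ" shows "inv_into UNIV (neg_e m) = neg_e (- m)"
  by (rule inv_unique_comp) (simp_all add: neg_e_comp assms perpQ_closed e_zero)

text \<open>Multiplying by \<open>- e m\<close> exchanges \<open>-id\<close> and \<open>e m\<close>, up to inverses.\<close>

lemma uminus_in_Gamma_iff:
  assumes m: "m \<in> perpQ" "neg_e m \<in> \<Gamma>"
  shows "uminus \<in> \<Gamma> \<longleftrightarrow> e m \<in> \<Gamma>"
proof
  assume "uminus \<in> \<Gamma>"
  then have "uminus \<circ> neg_e m \<in> \<Gamma>" using Gamma_comp m by blast
  then show "e m \<in> \<Gamma>" by (simp add: comp_def)
next
  assume "e m \<in> \<Gamma>"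
  then have "neg_e m \<circ> inv_into UNIV (e m) \<in> \<Gamma>" using Gamma_comp Gamma_inv m by blast
  then show "uminus \<in> \<Gamma>" using m perpQ_closed(4) by (simp add: e_inv neg_e_comp e_zero)
qed

lemma sign_perpQ:
  assumes "m \<in> perpQ" "\<epsilon> = 1 \<or> \<epsilon> = -1" shows "\<epsilon> *s m \<in> perpQ"
  using assms(2) by (intro perpQ_closed(3)[OF assms(1)]) auto

lemma UZ_normal: "UZ \<lhd> comp_group GZ"
proof -
  interpret group "comp_group GZ" by (rule perm_group_group[OF perm_group_GZ])
  have "g \<circ> u \<circ> inv_into UNIV g \<in> UZ" if g: "g \<in> GZ" and u: "u \<in> UZ" for g u
  proof -
    have gQ: "g \<in> GQ" using g GZ_GQ by blast
    obtain \<epsilon> where \<epsilon>: "\<epsilon> = 1 \<or> \<epsilon> = -1" "g l = \<epsilon> *s l" using GQ_sign[OF gQ] .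
    obtain m where m: "m \<in> perpQ" "u = e m" using u UZ_eq by auto
    have "\<epsilon> *s g m \<in> perpQ" by (rule sign_perpQ[OF GQ_perpQ[OF gQ m(1)] \<epsilon>(1)])
    moreover have "g \<circ> u \<circ> inv_into UNIV g \<in> \<Gamma>"
      using Gamma_comp Gamma_inv g u GZ_Gamma UZ_GZ by blast
    ultimately show ?thesis
      using conj_transvection[OF gQ m(1) \<epsilon>(2)] e_UZ_iff m(2) by simp
  qed
  then show ?thesis
    unfolding normal_inv_iff using perm_group_subgroup[OF perm_group_GZ perm_group_UZ UZ_GZ]
    by (simp add: perm_group_m_inv[OF perm_group_GZ])
qed

section \<open>The saturated unipotent group\<close>

abbreviation "U' \<equiv> UI_Z' B D \<Gamma> I"

text \<open>
  Linear maps commute with \<open>-id\<close>, so \<open>\<Gamma> \<union> -\<Gamma>\<close> is closed under products and inverses.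
\<close>

lemma generate_Gamma_uminus:
  "generate (comp_group (Oplus_Q B D)) (\<Gamma> \<union> {uminus}) = \<Gamma> \<union> (\<circ>) uminus ` \<Gamma>" (is "?L = ?R")
proof
  interpret group "comp_group (Oplus_Q B D)" by (rule perm_group_group[OF perm_group_Oplus_Q])
  have comm: "g \<circ> uminus = uminus \<circ> g" if "g \<in> \<Gamma>" for g
  proof -
    have "Vector_Spaces.linear (*s) (*s) g"
      using that Gamma_Oplus_Q orth_Q_D(1)[of g B] by (auto simp: Oplus_Q_def)
    then show ?thesis by (simp add: fun_eq_iff linear_simps(4))
  qed
  have mm: "uminus \<circ> (uminus \<circ> g) = g" for g :: "complex ^ 'a \<Rightarrow> complex ^ 'a"
    by (simp add: fun_eq_iff)
  have bij: "bij g" "inv_into UNIV g \<in> \<Gamma>" if "g \<in> \<Gamma>" for g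
    using that perm_group_Gamma by (auto simp: perm_group_def)
  have "perm_group ?R"
    unfolding perm_group_def
  proof (intro conjI ballI)
    show "id \<in> ?R" using perm_group_Gamma by (auto simp: perm_group_def)
    fix g h assume "g \<in> ?R" "h \<in> ?R"
    then obtain g' h' where g': "g' \<in> \<Gamma>" "g = g' \<or> g = uminus \<circ> g'"
      and h': "h' \<in> \<Gamma>" "h = h' \<or> h = uminus \<circ> h'" by blast
    have "g' \<circ> h' \<in> \<Gamma>" using g' h' Gamma_comp by blast
    moreover have "g \<circ> h = g' \<circ> h' \<or> g \<circ> h = uminus \<circ> (g' \<circ> h')"
      using g' h' comm[OF g'(1)] mm by (metis comp_assoc)
    ultimately show "g \<circ> h \<in> ?R" by auto
  next
    fix g assume "g \<in> ?R"
    then obtain g' where g': "g' \<in> \<Gamma>" "g = g' \<or> g = uminus \<circ> g'" by blast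
    define k where "k = inv_into UNIV g'"
    have k: "k \<in> \<Gamma>" "g' \<circ> k = id" "k \<circ> g' = id"
      using bij[OF g'(1)] inv_comp_inv by (auto simp: k_def)
    have 1: "(uminus \<circ> g') \<circ> (uminus \<circ> k) = id" "(uminus \<circ> k) \<circ> (uminus \<circ> g') = id"
      using k comm[OF k(1)] comm[OF g'(1)] mm by (metis comp_assoc)+
    from g'(2) show "bij g"
      using bij(1)[OF g'(1)] o_bij[OF 1(2,1)] by auto
    from g'(2) show "inv_into UNIV g \<in> ?R"
    proof
      assume "g = uminus \<circ> g'"
      then have "inv_into UNIV g = uminus \<circ> k" using inv_unique_comp[OF 1] by simp
      then show ?thesis using k by blast
    qed (use k in \<open>auto simp: k_def\<close>)
  qed
  moreover have "uminus \<circ> g \<in> Oplus_Q B D" if "g \<in> \<Gamma>" for g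
    using that Gamma_Oplus_Q uminus_Oplus_Q[OF D] perm_group_Oplus_Q[of B D]
    unfolding perm_group_def by blast
  then have "?R \<subseteq> Oplus_Q B D" using Gamma_Oplus_Q by blast
  ultimately have "subgroup ?R (comp_group (Oplus_Q B D))"
    by (intro perm_group_subgroup[OF perm_group_Oplus_Q])
  moreover have "uminus \<in> ?R"
    using perm_group_Gamma by (auto simp: perm_group_def image_iff intro!: bexI[of _ id])
  ultimately show "?L \<subseteq> ?R" by (intro generate_subgroup_incl) auto
  show "?R \<subseteq> ?L"
  proof
    fix g assume "g \<in> ?R"
    then consider "g \<in> \<Gamma>" | g' where "g' \<in> \<Gamma>" "g = uminus \<circ> g'" by blast
    then show "g \<in> ?L"
    proof cases
      case 2
      then show ?thesis
        using generate.eng[of uminus "comp_group (Oplus_Q B D)" "\<Gamma> \<union> {uminus}" g']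
        by (simp add: generate.incl)
    qed (simp add: generate.incl)
  qed
qed

lemma U'_eq: "U' = e ` {m \<in> perpQ. e m \<in> \<Gamma> \<or> neg_e m \<in> \<Gamma>}"
proof -
  have "e m \<in> (\<circ>) uminus ` \<Gamma> \<longleftrightarrow> neg_e m \<in> \<Gamma>" for m
  proof
    assume "e m \<in> (\<circ>) uminus ` \<Gamma>"
    then obtain g where "g \<in> \<Gamma>" "e m = uminus \<circ> g" by blast
    moreover from this have "neg_e m = g" by (simp add: fun_eq_iff)
    ultimately show "neg_e m \<in> \<Gamma>" by simp
  next
    assume "neg_e m \<in> \<Gamma>"
    moreover have "e m = uminus \<circ> neg_e m" by (simp add: fun_eq_iff)
    ultimately show "e m \<in> (\<circ>) uminus ` \<Gamma>" by blast
  qed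
  then show ?thesis unfolding UI_Z'_def generate_Gamma_uminus UQ_eq by blast
qed

lemma UZ_neq_U'_iff: "UZ \<noteq> U' \<longleftrightarrow> uminus \<notin> \<Gamma> \<and> (\<exists>m\<in>perpQ. neg_e m \<in> \<Gamma>)"
proof
  assume "UZ \<noteq> U'"
  moreover have "UZ \<subseteq> U'" by (auto simp: UZ_eq U'_eq)
  ultimately obtain m where "m \<in> perpQ" "e m \<notin> \<Gamma>" "neg_e m \<in> \<Gamma>"
    by (auto simp: UZ_eq U'_eq)
  then show "uminus \<notin> \<Gamma> \<and> (\<exists>m\<in>perpQ. neg_e m \<in> \<Gamma>)" using uminus_in_Gamma_iff by blast
next
  assume "uminus \<notin> \<Gamma> \<and> (\<exists>m\<in>perpQ. neg_e m \<in> \<Gamma>)"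
  then obtain m where "m \<in> perpQ" "e m \<notin> \<Gamma>" "neg_e m \<in> \<Gamma>" using uminus_in_Gamma_iff by blast
  then show "UZ \<noteq> U'" using e_UZ_iff unfolding U'_eq by blast
qed

text \<open>
  Two elements of \<open>U(I)'\<^sub>\<int>\<close> outside \<open>\<Gamma>\<close> become elements of \<open>\<Gamma>\<close> after a change of sign, and the
  signs cancel in their quotient; so there are only two cosets.
\<close>

lemma saturation_quotient:
  assumes m: "m \<in> perpQ" "neg_e m \<in> \<Gamma>" and nm: "uminus \<notin> \<Gamma>"
  defines "Q \<equiv> comp_group U' Mod UZ"
  shows "carrier Q = generate Q {UZ #>\<^bsub>comp_group U'\<^esub> e m}" "Q \<cong> integer_mod_group 2"
proof -
  define a where "a = UZ #>\<^bsub>comp_group U'\<^esub> e m"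
  have em: "e m \<notin> \<Gamma>" using uminus_in_Gamma_iff m nm by blast
  have pU': "perm_group U'"
    unfolding UI_Z'_def generate_Gamma_uminus[symmetric]
  proof (rule perm_group_Int[OF perm_group_UQ])
    interpret group "comp_group (Oplus_Q B D)" by (rule perm_group_group[OF perm_group_Oplus_Q])
    show "perm_group (generate (comp_group (Oplus_Q B D)) (\<Gamma> \<union> {uminus}))"
      by (rule subgroup_perm_group[OF perm_group_Oplus_Q generate_is_subgroup])
        (use Gamma_Oplus_Q uminus_Oplus_Q[OF D] in auto)
  qed
  interpret U': group "comp_group U'" by (rule perm_group_group[OF pU'])
  have sub: "UZ \<subseteq> U'" by (auto simp: UZ_eq U'_eq)
  note coset_eq = comp_group_coset_eq_iff[OF pU' perm_group_UZ sub]
  have emU: "e m \<in> U'" using m by (auto simp: U'_eq)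
  have normal: "UZ \<lhd> comp_group U'"
    unfolding U'.normal_inv_iff
  proof (intro conjI ballI)
    show "subgroup UZ (comp_group U')" by (rule perm_group_subgroup[OF pU' perm_group_UZ sub])
    fix g u assume g: "g \<in> carrier (comp_group U')" and u: "u \<in> UZ"
    obtain m1 m2 where *: "m1 \<in> perpQ" "g = e m1" "m2 \<in> perpQ" "u = e m2"
      using g u by (auto simp: UZ_eq U'_eq)
    have "g \<circ> u \<circ> inv_into UNIV g = u" using * perpQ_closed by (simp add: e_inv e_comp)
    then show "g \<otimes>\<^bsub>comp_group U'\<^esub> u \<otimes>\<^bsub>comp_group U'\<^esub> inv\<^bsub>comp_group U'\<^esub> g \<in> UZ"
      using u g by (simp add: perm_group_m_inv[OF pU'])
  qed
  have grp: "group Q" unfolding Q_def by (rule normal.factorgroup_is_group[OF normal])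
  have one: "\<one>\<^bsub>Q\<^esub> = UZ" by (simp add: Q_def)
  have car: "carrier Q = {\<one>\<^bsub>Q\<^esub>, a}"
  proof -
    have "UZ #>\<^bsub>comp_group U'\<^esub> g \<in> {UZ, a}" if gU: "g \<in> U'" for g
    proof -
      obtain m' where m': "m' \<in> perpQ" "g = e m'" "e m' \<in> \<Gamma> \<or> neg_e m' \<in> \<Gamma>"
        using gU unfolding U'_eq by blast
      from m'(3) show ?thesis
      proof
        assume "e m' \<in> \<Gamma>"
        then have "g \<in> UZ" using m' e_UZ_iff by simp
        then show ?thesis using U'.coset_join2[OF _ perm_group_subgroup[OF pU' perm_group_UZ sub], of g] gU by simp
      next
        assume "neg_e m' \<in> \<Gamma>"
        then have "neg_e m' \<circ> inv_into UNIV (neg_e m) \<in> \<Gamma>" using m Gamma_comp Gamma_inv by blast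
        then have "e (m' - m) \<in> \<Gamma>" using m m' by (simp add: neg_e_inv neg_e_comp perpQ_closed)
        then have "e m' \<circ> inv_into UNIV (e m) \<in> UZ"
          using m m' perpQ_closed(2)[OF m'(1) m(1)] by (simp add: e_inv e_comp perpQ_closed e_UZ_iff)
        then show ?thesis using coset_eq[OF gU emU] m' by (simp add: a_def)
      qed
    qed
    moreover have "UZ = UZ #>\<^bsub>comp_group U'\<^esub> id" by (simp add: comp_group_coset)
    moreover have "id \<in> U'" using pU' by (simp add: perm_group_def)
    ultimately show ?thesis using emU
      unfolding one unfolding Q_def carrier_FactGroup carrier_comp_group a_def by blast
  qed
  have a: "a \<in> carrier Q" "a \<noteq> \<one>\<^bsub>Q\<^esub>"
  proof -
    show "a \<in> carrier Q" using car by simp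
    have "e m \<in> a" unfolding a_def
      by (rule U'.rcos_self) (use emU perm_group_subgroup[OF pU' perm_group_UZ sub] in auto)
    moreover have "e m \<notin> UZ" using em m e_UZ_iff by simp
    ultimately show "a \<noteq> \<one>\<^bsub>Q\<^esub>" unfolding one by blast
  qed
  interpret Q: group Q by (rule grp)
  have aa: "a \<otimes>\<^bsub>Q\<^esub> a = \<one>\<^bsub>Q\<^esub>"
    using Q.m_closed[OF a(1) a(1)] Q.l_cancel_one[OF a(1) a(1)] a(2) car by auto
  have car': "Q\<lparr>carrier := {\<one>\<^bsub>Q\<^esub>, a}\<rparr> = Q" unfolding car[symmetric] by simp
  show "carrier Q = generate Q {UZ #>\<^bsub>comp_group U'\<^esub> e m}"
    using involution_subgroup(1)[OF grp a(1) aa a(2)] car unfolding a_def by simp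
  show "Q \<cong> integer_mod_group 2"
    using involution_subgroup(2)[OF grp a(1) aa a(2)] unfolding car' .
qed

section \<open>The conjugation action\<close>

lemma UI_lattice_eq: "\<Lambda> = q ` {m \<in> perpQ. e m \<in> \<Gamma>}"
  unfolding UI_lattice_def LI_eq[of \<rat>, simplified]
  using e_UZ_iff transvection_q perpQ_bil by auto

lemma inv_transvection:
  assumes "m \<in> perpQ" shows "inv_into (LI B I \<rat>) (transvection B I) (e m) = q m"
proof -
  have "inj_on (transvection B I) (LI B I \<rat>)"
    by (rule inj_onI) (auto simp: LI_eq transvection_q perpQ_bil e_eq_iff)
  from inv_into_f_f[OF this, of "q m"] show ?thesis
    using assms by (simp add: LI_eq transvection_q perpQ_bil)
qed

text \<open>
  Conjugation is the natural action: the image of \<open>m \<otimes> l\<close> is \<open>g m \<otimes> g l = \<epsilon> g m \<otimes> l\<close>.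
\<close>

lemma conj_action_q:
  assumes g: "g \<in> GZ" and m: "m \<in> perpQ" "e m \<in> \<Gamma>" and \<epsilon>: "\<epsilon> = 1 \<or> \<epsilon> = -1" "g l = \<epsilon> *s l"
  shows "conj_action B D \<Gamma> I g (q m) = q (\<epsilon> *s g m)"
proof -
  have gQ: "g \<in> GQ" using g GZ_GQ by blast
  have "\<epsilon> *s g m \<in> perpQ" by (rule sign_perpQ[OF GQ_perpQ[OF gQ m(1)] \<epsilon>(1)])
  moreover have "q m \<in> \<Lambda>" using m by (auto simp: UI_lattice_eq)
  ultimately show ?thesis
    using conj_transvection[OF gQ m(1) \<epsilon>(2)] m
    by (simp add: conj_action_def perm_group_m_inv[OF perm_group_GZ g] transvection_q perpQ_bil inv_transvection)
qed

lemma sign_smult_cancel: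
  assumes "\<epsilon> = 1 \<or> \<epsilon> = (-1 :: complex)"
  shows "\<epsilon> *s (\<epsilon> *s v) = v"
  using assms by auto

text \<open>
  This carries condition (3). From left to right, agreement on \<open>U(I)\<^sub>\<int>\<close> spreads to all rational
  \<open>m\<close> by scaling, since a multiple of \<open>m\<close> lies in \<open>U(I)\<^sub>\<int>\<close>; the quotient then acts trivially on
  \<open>L(I)\<close> and is unipotent up to sign. From right to left, \<open>e m\<close> moves vectors of \<open>I\<^sup>\<bottom>\<close> by
  multiples of \<open>l\<close> only, and the sign of \<open>- e m\<close> acts twice on \<open>g m \<otimes> g l\<close>.
\<close>

lemma conj_action_eq_iff:
  assumes g: "g \<in> GZ" and h: "h \<in> GZ"
  shows "conj_action B D \<Gamma> I g = conj_action B D \<Gamma> I h \<longleftrightarrow>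
    (\<exists>m\<in>perpQ. g \<circ> inv_into UNIV h = e m \<or> g \<circ> inv_into UNIV h = neg_e m)"
proof -
  have gQ: "g \<in> GQ" and hQ: "h \<in> GQ" using g h GZ_GQ by auto
  obtain \<epsilon> where \<epsilon>: "\<epsilon> = 1 \<or> \<epsilon> = -1" "g l = \<epsilon> *s l" using GQ_sign[OF gQ] .
  obtain \<delta> where \<delta>: "\<delta> = 1 \<or> \<delta> = -1" "h l = \<delta> *s l" using GQ_sign[OF hQ] .
  define k where "k = inv_into UNIV h"
  have kQ: "k \<in> GQ" using hQ perm_group_GammaI_Q[of B D I] by (auto simp: perm_group_def k_def)
  have hk: "h (k v) = v" "k (h v) = v" for v
    using GQ_D(3)[OF hQ] by (simp_all add: k_def bij_is_surj surj_f_inv_f bij_is_inj)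
  note ling = linear_simps[OF GQ_D(1)[OF gQ]] and linh = linear_simps[OF GQ_D(1)[OF hQ]]
  show ?thesis
  proof
    assume eq: "conj_action B D \<Gamma> I g = conj_action B D \<Gamma> I h"
    have *: "\<exists>c. \<epsilon> *s g m - \<delta> *s h m = c *s l" if m: "m \<in> perpQ" for m
    proof -
      obtain N :: nat where N: "N > 0" "e (of_nat N *s m) \<in> \<Gamma>" using multiple_in_Gamma[OF m] .
      have Nm: "of_nat N *s m \<in> perpQ" using perpQ_closed(3)[OF m] by simp
      have "q (\<epsilon> *s g (of_nat N *s m)) = q (\<delta> *s h (of_nat N *s m))"
        using conj_action_q[OF g Nm N(2) \<epsilon>] conj_action_q[OF h Nm N(2) \<delta>] eq by simp
      then obtain c where "\<epsilon> *s g (of_nat N *s m) - \<delta> *s h (of_nat N *s m) = c *s l"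
        unfolding q_eq ..
      then have "of_nat N *s (\<epsilon> *s g m - \<delta> *s h m) = c *s l"
        by (simp add: ling(3) linh(3) vec_eq_iff algebra_simps)
      then have "\<epsilon> *s g m - \<delta> *s h m = (c / of_nat N) *s l"
        using N(1) by (simp add: vec_eq_iff field_simps)
      then show ?thesis by blast
    qed
    have "\<exists>m\<in>perpQ. g \<circ> k = e m \<or> g \<circ> k = uminus \<circ> e m"
    proof (rule sign_twist_unipotent)
      show "g \<circ> k \<in> GQ" using gQ kQ perm_group_GammaI_Q[of B D I] by (auto simp: perm_group_def)
      show "\<epsilon> * \<delta> = 1 \<or> \<epsilon> * \<delta> = - 1" using \<epsilon>(1) \<delta>(1) by auto
      have "k l = \<delta> *s l"
      proof -
        have "\<delta> * \<delta> = 1" using \<delta>(1) by auto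
        then have "h (\<delta> *s l) = l" by (simp add: linh \<delta>(2))
        then show ?thesis using hk(2)[of "\<delta> *s l"] by simp
      qed
      then show "(g \<circ> k) l = (\<epsilon> * \<delta>) *s l" by (simp add: ling \<epsilon>(2) vector_smult_assoc mult.commute)
      fix m assume m: "m \<in> perpQ"
      obtain c where "\<epsilon> *s g (k m) - \<delta> *s h (k m) = c *s l" using *[OF GQ_perpQ[OF kQ m]] by blast
      then have "\<delta> *s (\<epsilon> *s g (k m) - \<delta> *s m) = \<delta> *s (c *s l)" by (simp add: hk)
      then have "(\<epsilon> * \<delta>) *s (g \<circ> k) m - m = (\<delta> * c) *s l"
        using sign_smult_cancel[OF \<delta>(1), of m]
        by (simp add: vec_eq_iff algebra_simps)
      then show "\<exists>c. (\<epsilon> * \<delta>) *s (g \<circ> k) m - m = c *s l" by blast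
    qed
    then show "\<exists>m\<in>perpQ. g \<circ> inv_into UNIV h = e m \<or> g \<circ> inv_into UNIV h = neg_e m"
      by (simp add: k_def)
  next
    assume "\<exists>m\<in>perpQ. g \<circ> inv_into UNIV h = e m \<or> g \<circ> inv_into UNIV h = neg_e m"
    \<comment> \<open>Treat \<open>e m\<close> and \<open>- e m\<close> together, with \<open>\<eta>\<close> as the sign.\<close>
    then obtain m \<eta> where m: "m \<in> perpQ" and \<eta>: "\<eta> = 1 \<or> \<eta> = (-1 :: complex)"
      and "\<And>v. g (k v) = \<eta> *s e m v"
      by (simp add: k_def[symmetric] fun_eq_iff)
        (metis vector_sneg_minus1 vec.scale_one)
    then have gh: "g v = \<eta> *s e m (h v)" for v using hk(2) by metis
    have "e m (h l) = h l" using e_fixes_l[OF perpQ_bil[OF m]] linear_simps(3)[OF eichler_linear] \<delta>(2) by metis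
    then have "\<epsilon> *s l = (\<eta> * \<delta>) *s l" using gh[of l] \<epsilon>(2) \<delta>(2) by (simp add: vector_smult_assoc)
    then have e: "\<epsilon> = \<eta> * \<delta>" using scale_l_eq by blast
    show "conj_action B D \<Gamma> I g = conj_action B D \<Gamma> I h"
    proof
      fix w show "conj_action B D \<Gamma> I g w = conj_action B D \<Gamma> I h w"
      proof (cases "w \<in> \<Lambda>")
        case True
        then obtain n where n: "n \<in> perpQ" "e n \<in> \<Gamma>" "w = q n" by (auto simp: UI_lattice_eq)
        have "bil B l (h n) = 0" using perpQ_bil[OF GQ_perpQ[OF hQ n(1)]] bil_sym by metis
        then have "\<epsilon> *s g n - \<delta> *s h n = (- \<delta> * bil B m (h n)) *s l"
          using \<eta> by (auto simp: e gh eichler_def vec_eq_iff algebra_simps)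
        then have "q (\<epsilon> *s g n) = q (\<delta> *s h n)" unfolding q_eq by blast
        then show ?thesis using conj_action_q[OF g n(1,2) \<epsilon>] conj_action_q[OF h n(1,2) \<delta>] n(3) by simp
      qed (simp add: conj_action_def)
    qed
  qed
qed

section \<open>The kernel of the natural map\<close>

abbreviation "G \<equiv> GammaI_bar B D \<Gamma> I"
abbreviation "cls g \<equiv> UZ #>\<^bsub>comp_group GZ\<^esub> g"
abbreviation "\<rho> \<equiv> natural_map B D \<Gamma> I"

lemma id_GZ: "id \<in> GZ" using perm_group_GZ by (simp add: perm_group_def)

lemma cls_id: "cls id = UZ" by (simp add: comp_group_coset)

lemma group_G: "group G"
  unfolding GammaI_bar_def by (rule normal.factorgroup_is_group[OF UZ_normal])

lemma carrier_G: "carrier G = cls ` GZ"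
  by (simp add: GammaI_bar_def carrier_FactGroup)

lemma one_G: "\<one>\<^bsub>G\<^esub> = UZ" by (simp add: GammaI_bar_def)

lemma mult_G: "g \<in> GZ \<Longrightarrow> h \<in> GZ \<Longrightarrow> cls g \<otimes>\<^bsub>G\<^esub> cls h = cls (g \<circ> h)"
  using normal.rcos_sum[OF UZ_normal, of g h] by (simp add: GammaI_bar_def FactGroup_def)

lemma cls_eq_iff: "g \<in> GZ \<Longrightarrow> h \<in> GZ \<Longrightarrow> cls g = cls h \<longleftrightarrow> g \<circ> inv_into UNIV h \<in> UZ"
  by (rule comp_group_coset_eq_iff[OF perm_group_GZ perm_group_UZ UZ_GZ])

lemma natural_map_cls:
  assumes g: "g \<in> GZ" shows "\<rho> (cls g) = conj_action B D \<Gamma> I g"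
proof -
  have "conj_action B D \<Gamma> I (u \<circ> g) = conj_action B D \<Gamma> I g" if u: "u \<in> UZ" for u
  proof -
    have "u \<circ> g \<in> GZ" using u g UZ_GZ perm_group_GZ by (auto simp: perm_group_def)
    moreover have "u \<circ> g \<circ> inv_into UNIV g = u"
      using perm_group_GZ g by (simp add: perm_group_def comp_assoc inv_comp_inv)
    moreover obtain m where "m \<in> perpQ" "u = e m" using u by (auto simp: UZ_eq)
    ultimately show ?thesis using conj_action_eq_iff[OF _ g] by auto
  qed
  moreover have "id \<in> UZ" using perm_group_UZ by (simp add: perm_group_def)
  ultimately have "conj_action B D \<Gamma> I ` cls g = {conj_action B D \<Gamma> I g}"
    unfolding comp_group_coset image_image by (intro equalityI) (auto intro: image_eqI[of _ _ id])
  then show ?thesis by (simp add: natural_map_def)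
qed

text \<open>It acts on \<open>l\<close> by \<open>-1\<close>, whereas unipotent elements fix \<open>l\<close>.\<close>

lemma neg_e_notin_UZ:
  assumes "m \<in> perpQ" shows "neg_e m \<notin> UZ"
proof
  assume "neg_e m \<in> UZ"
  then obtain m' where m': "m' \<in> perpQ" "neg_e m = e m'" by (auto simp: UZ_eq)
  then have "neg_e m l = e m' l" by simp
  then have "- l = l"
    using e_fixes_l[OF perpQ_bil[OF assms]] e_fixes_l[OF perpQ_bil[OF m'(1)]] by (metis comp_apply)
  then have "(- 1) *s l = 1 *s l" by (simp add: vec_eq_iff)
  then show False unfolding scale_l_eq by simp
qed

text \<open>
  Two elements with the same action differ by \<open>e m\<close> or \<open>- e m\<close>; in the first case they have
  the same class modulo \<open>U(I)\<^sub>\<int>\<close>. Conversely \<open>- e m\<close> acts like the identity without lying in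
  \<open>U(I)\<^sub>\<int>\<close>.
\<close>

lemma natural_map_not_inj_iff:
  "\<not> inj_on \<rho> (carrier G) \<longleftrightarrow> (\<exists>m\<in>perpQ. neg_e m \<in> \<Gamma>)"
proof
  assume "\<not> inj_on \<rho> (carrier G)"
  then obtain g h where gh: "g \<in> GZ" "h \<in> GZ" "\<rho> (cls g) = \<rho> (cls h)" "cls g \<noteq> cls h"
    by (auto simp: inj_on_def carrier_G)
  have k: "g \<circ> inv_into UNIV h \<in> GZ" using gh perm_group_GZ by (auto simp: perm_group_def)
  have "conj_action B D \<Gamma> I g = conj_action B D \<Gamma> I h" using gh natural_map_cls by simp
  then obtain m where m: "m \<in> perpQ" "g \<circ> inv_into UNIV h = e m \<or> g \<circ> inv_into UNIV h = neg_e m"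
    using conj_action_eq_iff[OF gh(1,2)] by blast
  have "g \<circ> inv_into UNIV h \<notin> UZ" using gh cls_eq_iff by simp
  then have "g \<circ> inv_into UNIV h \<noteq> e m" using k GZ_Gamma m(1) e_UZ_iff by auto
  then show "\<exists>m\<in>perpQ. neg_e m \<in> \<Gamma>" using m k GZ_Gamma by auto
next
  assume "\<exists>m\<in>perpQ. neg_e m \<in> \<Gamma>"
  then obtain m where m: "m \<in> perpQ" "neg_e m \<in> GZ" using neg_e_GZ_iff by blast
  have "conj_action B D \<Gamma> I (neg_e m) = conj_action B D \<Gamma> I id"
    using conj_action_eq_iff[OF m(2) id_GZ] m(1) by auto
  then have "\<rho> (cls (neg_e m)) = \<rho> (cls id)" using natural_map_cls m id_GZ by simp
  moreover have "cls (neg_e m) \<noteq> cls id" using cls_eq_iff[OF m(2) id_GZ] neg_e_notin_UZ[OF m(1)] by simp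
  ultimately show "\<not> inj_on \<rho> (carrier G)"
    using m id_GZ unfolding carrier_G inj_on_def by blast
qed

lemma conj_action_id: "conj_action B D \<Gamma> I id = (\<lambda>w\<in>\<Lambda>. w)"
proof
  fix w show "conj_action B D \<Gamma> I id w = (\<lambda>w\<in>\<Lambda>. w) w"
  proof (cases "w \<in> \<Lambda>")
    case True
    then obtain m where "m \<in> perpQ" "e m \<in> \<Gamma>" "w = q m" by (auto simp: UI_lattice_eq)
    then show ?thesis using conj_action_q[OF id_GZ, of m 1] True by simp
  qed (simp add: conj_action_def)
qed

lemma one_Oplus_UI: "\<one>\<^bsub>Oplus_UI B D \<Gamma> I\<^esub> = (\<lambda>w\<in>\<Lambda>. w)"
  by (simp add: Oplus_UI_def Let_def AutoGroup_def BijGroup_def)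

text \<open>
  Elements acting trivially are \<open>e m'\<close> or \<open>- e m'\<close>, and in the second case they agree with
  \<open>- e m\<close> modulo \<open>e (m' - m) \<in> U(I)\<^sub>\<int>\<close>.
\<close>

lemma kernel_natural_map:
  assumes m: "m \<in> perpQ" "neg_e m \<in> \<Gamma>"
  defines "N \<equiv> kernel G (Oplus_UI B D \<Gamma> I) \<rho>"
  shows "N = generate G {cls (neg_e m)}" "G\<lparr>carrier := N\<rparr> \<cong> integer_mod_group 2"
proof -
  have mG: "neg_e m \<in> GZ" using m neg_e_GZ_iff by simp
  have "cls g \<in> {UZ, cls (neg_e m)}" if g: "g \<in> GZ" "\<rho> (cls g) = (\<lambda>w\<in>\<Lambda>. w)" for g
  proof -
    have "conj_action B D \<Gamma> I g = conj_action B D \<Gamma> I id" using g natural_map_cls conj_action_id by simp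
    then obtain m' where m': "m' \<in> perpQ" "g = e m' \<or> g = neg_e m'"
      using conj_action_eq_iff[OF g(1) id_GZ] by auto
    from m'(2) show ?thesis
    proof
      assume "g = e m'"
      then have "g \<circ> inv_into UNIV id \<in> UZ" using m' g GZ_Gamma e_UZ_iff by auto
      then show ?thesis using cls_eq_iff[OF g(1) id_GZ] cls_id by simp
    next
      assume gm: "g = neg_e m'"
      then have "g \<circ> inv_into UNIV (neg_e m) = e (m' - m)"
        using m m' by (simp add: neg_e_inv neg_e_comp perpQ_closed)
      moreover have "g \<circ> inv_into UNIV (neg_e m) \<in> \<Gamma>" using g GZ_Gamma m Gamma_comp Gamma_inv by blast
      ultimately have "g \<circ> inv_into UNIV (neg_e m) \<in> UZ"
        using e_UZ_iff perpQ_closed(2)[OF m'(1) m(1)] by simp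
      then show ?thesis using cls_eq_iff[OF g(1) mG] by simp
    qed
  qed
  moreover have "\<rho> UZ = (\<lambda>w\<in>\<Lambda>. w)" using natural_map_cls[OF id_GZ] cls_id conj_action_id by simp
  moreover have "\<rho> (cls (neg_e m)) = (\<lambda>w\<in>\<Lambda>. w)"
  proof -
    have "conj_action B D \<Gamma> I (neg_e m) = conj_action B D \<Gamma> I id"
      using conj_action_eq_iff[OF mG id_GZ] m(1) by auto
    then show ?thesis using natural_map_cls[OF mG] conj_action_id by simp
  qed
  moreover have "UZ \<in> cls ` GZ" using id_GZ cls_id by (metis image_eqI)
  ultimately have N: "N = {\<one>\<^bsub>G\<^esub>, cls (neg_e m)}"
    unfolding N_def kernel_def carrier_G one_Oplus_UI one_G using mG by auto
  have a: "cls (neg_e m) \<in> carrier G" using mG by (simp add: carrier_G)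
  have "cls (neg_e m) \<noteq> cls id" using cls_eq_iff[OF mG id_GZ] neg_e_notin_UZ[OF m(1)] by simp
  then have ne: "cls (neg_e m) \<noteq> \<one>\<^bsub>G\<^esub>" by (simp add: one_G cls_id)
  have mm: "neg_e m \<circ> neg_e m \<in> GZ" using mG perm_group_GZ by (auto simp: perm_group_def)
  have "neg_e m \<circ> neg_e m \<circ> inv_into UNIV id \<in> UZ"
    using mm m GZ_Gamma e_UZ_iff[OF perpQ_closed(1)[OF m(1) m(1)]] by (auto simp: neg_e_comp)
  then have "cls (neg_e m \<circ> neg_e m) = UZ" using cls_eq_iff[OF mm id_GZ] cls_id by simp
  then have "cls (neg_e m) \<otimes>\<^bsub>G\<^esub> cls (neg_e m) = \<one>\<^bsub>G\<^esub>" using mult_G[OF mG mG] by (simp add: one_G)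
  then show "N = generate G {cls (neg_e m)}" "G\<lparr>carrier := N\<rparr> \<cong> integer_mod_group 2"
    using involution_subgroup[OF group_G a _ ne] unfolding N by auto
qed

section \<open>The tube domain\<close>

abbreviation "LIC \<equiv> LI_group B I UNIV"
abbreviation "TT \<equiv> torus B D \<Gamma> I"
abbreviation "tb \<equiv> tube B I l w'"

lemma perpC_closed:
  "m \<in> perp B I UNIV \<Longrightarrow> m' \<in> perp B I UNIV \<Longrightarrow> m + m' \<in> perp B I UNIV"
  "m \<in> perp B I UNIV \<Longrightarrow> - m \<in> perp B I UNIV" "0 \<in> perp B I UNIV"
  "m \<in> perpQ \<Longrightarrow> m \<in> perp B I UNIV"
  by (auto simp: mem_perp bil_simps lat_def) (simp add: bil_def)

lemma LIC_simps: "carrier LIC = q ` perp B I UNIV" "x \<otimes>\<^bsub>LIC\<^esub> y = x + y" "\<one>\<^bsub>LIC\<^esub> = q 0"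
  by (auto simp: LI_group_def LI_eq tens_II_eq)

lemma comm_group_LIC: "comm_group LIC"
proof (rule comm_groupI, unfold LIC_simps)
  fix x assume "x \<in> q ` perp B I UNIV"
  then obtain m where m: "m \<in> perp B I UNIV" "x = q m" by blast
  then show "\<exists>y\<in>q ` perp B I UNIV. y + x = q 0"
    by (intro bexI[of _ "q (- m)"]) (auto simp: q_add perpC_closed)
qed (auto simp: q_add perpC_closed add_ac)

lemma UI_lattice_subgroup: "subgroup \<Lambda> LIC"
proof -
  interpret comm_group LIC by (rule comm_group_LIC)
  show ?thesis
  proof (rule subgroupI)
    show "\<Lambda> \<subseteq> carrier LIC" unfolding UI_lattice_eq LIC_simps using perpC_closed(4) by blast
    have "id \<in> \<Gamma>" using perm_group_Gamma by (simp add: perm_group_def)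
    then show "\<Lambda> \<noteq> {}" unfolding UI_lattice_eq using perpQ_closed(5) e_zero by auto
    fix x assume "x \<in> \<Lambda>"
    then obtain m where m: "m \<in> perpQ" "e m \<in> \<Gamma>" "x = q m" by (auto simp: UI_lattice_eq)
    have "inv\<^bsub>LIC\<^esub> x = q (- m)"
      by (rule inv_equality) (use m perpC_closed in \<open>auto simp: LIC_simps q_add\<close>)
    moreover have "e (- m) \<in> \<Gamma>" using Gamma_inv[OF m(2)] m by (simp add: e_inv)
    ultimately show "inv\<^bsub>LIC\<^esub> x \<in> \<Lambda>" using m perpQ_closed by (auto simp: UI_lattice_eq)
    fix y assume "y \<in> \<Lambda>"
    then obtain m' where m': "m' \<in> perpQ" "e m' \<in> \<Gamma>" "y = q m'" by (auto simp: UI_lattice_eq)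
    have "e (m + m') \<in> \<Gamma>" using Gamma_comp[OF m(2) m'(2)] m m' by (simp add: e_comp)
    then show "x \<otimes>\<^bsub>LIC\<^esub> y \<in> \<Lambda>"
      using m m' perpQ_closed by (auto simp: UI_lattice_eq LIC_simps q_add)
  qed
qed

lemma UI_lattice_normal: "\<Lambda> \<lhd> LIC"
  using comm_group.subgroup_imp_normal[OF comm_group_LIC UI_lattice_subgroup] .

lemma UI_lattice_coset_eq:
  assumes "x \<in> carrier LIC" "y \<in> carrier LIC"
  shows "(\<Lambda> #>\<^bsub>LIC\<^esub> x = \<Lambda> #>\<^bsub>LIC\<^esub> y) \<longleftrightarrow> (\<exists>z\<in>\<Lambda>. x = z + y)"
proof -
  interpret comm_group LIC by (rule comm_group_LIC)
  have "(\<Lambda> #>\<^bsub>LIC\<^esub> x = \<Lambda> #>\<^bsub>LIC\<^esub> y) \<longleftrightarrow> x \<in> \<Lambda> #>\<^bsub>LIC\<^esub> y"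
    using repr_independence[OF _ assms(2) UI_lattice_subgroup] rcos_self[OF assms(1) UI_lattice_subgroup] by metis
  then show ?thesis by (auto simp: r_coset_def LIC_simps)
qed

lemma UI_lattice_coset_add:
  assumes "x \<in> carrier LIC" "y \<in> carrier LIC"
  shows "(\<Lambda> #>\<^bsub>LIC\<^esub> x) \<otimes>\<^bsub>TT\<^esub> (\<Lambda> #>\<^bsub>LIC\<^esub> y) = \<Lambda> #>\<^bsub>LIC\<^esub> (x + y)"
  using normal.rcos_sum[OF UI_lattice_normal assms] by (simp add: torus_def FactGroup_def LIC_simps)

lemma group_TT: "group TT"
  unfolding torus_def by (rule normal.factorgroup_is_group[OF UI_lattice_normal])

lemma carrier_TT: "carrier TT = (\<lambda>m. \<Lambda> #>\<^bsub>LIC\<^esub> q m) ` perp B I UNIV"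
  by (simp add: torus_def carrier_FactGroup LIC_simps image_image)

lemma one_TT: "\<one>\<^bsub>TT\<^esub> = \<Lambda>" by (simp add: torus_def)

text \<open>
  A period can be rescaled to pair to \<open>1\<close> with \<open>l\<close> because it is not orthogonal to \<open>l\<close>.
\<close>

lemma normalized_period:
  assumes "x \<in> D" obtains \<omega> where "x = line \<omega>" "bil B \<omega> l = 1"
proof -
  obtain \<omega> where \<omega>: "x = line \<omega>" "bil B \<omega> \<omega> = 0" "Re (bil B \<omega> (conj_vec \<omega>)) > 0"
    using period_component_cases[OF D assms] .
  have nz: "bil B \<omega> l \<noteq> 0"
    using period_not_orthogonal_to_isotropic[OF sym sig lat_Rats_Reals[OF lat_Ints_Rats[OF l_int]] iso _ \<omega>(2,3), of w']
      pair by simp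
  define a where "a = 1 / bil B \<omega> l"
  have "line (a *s \<omega>) = line \<omega>"
  proof -
    have "c *s (a *s \<omega>) = (c * a) *s \<omega>" "c *s \<omega> = (c * bil B \<omega> l) *s (a *s \<omega>)" for c
      using nz by (auto simp: vec_eq_iff a_def)
    then show ?thesis unfolding line_def by (intro equalityI image_subsetI) (metis rangeI)+
  qed
  moreover have "bil B (a *s \<omega>) l = 1" using nz by (simp add: a_def bil_simps)
  ultimately show thesis using that \<omega>(1) by metis
qed

lemma tube_line:
  assumes "bil B \<omega> l = 1" shows "tb (line \<omega>) = q (\<omega> - w')"
proof -
  have "{q (\<omega>' - w') | \<omega>'. \<omega>' \<in> line \<omega> \<and> bil B \<omega>' l = 1} = {q (\<omega> - w')}"
  proof -
    have "\<omega>' = \<omega>" if "\<omega>' \<in> line \<omega>" "bil B \<omega>' l = 1" for \<omega>'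
      using that assms by (auto simp: line_def bil_simps)
    moreover have "1 *s \<omega> \<in> line \<omega>" unfolding line_def by blast
    ultimately show ?thesis using assms by auto
  qed
  then show ?thesis by (simp add: tube_def)
qed

lemma tube_carrier:
  assumes "x \<in> D" shows "tb x \<in> carrier LIC"
proof -
  obtain \<omega> where "x = line \<omega>" "bil B \<omega> l = 1" using normalized_period[OF assms] .
  then show ?thesis using pair
    by (auto simp: tube_line LIC_simps mem_perp bil_simps lat_def)
qed

text \<open>
  Modulo \<open>l\<close>, a transvection acts on the vectors with \<open>(\<omega>, l) = 1\<close> as the translation by \<open>m\<close>.
\<close>

lemma e_normalized:
  assumes "bil B m l = 0" "bil B \<omega> l = 1"
  shows "\<exists>c. e m \<omega> = \<omega> + m + c *s l" "bil B (e m \<omega>) l = 1"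
proof -
  have "e m \<omega> = \<omega> + m + (- bil B m \<omega> - 1 / 2 * bil B m m) *s l"
    using assms(2) bil_sym[of l \<omega>] by (simp add: eichler_def vec_eq_iff algebra_simps)
  then show "\<exists>c. e m \<omega> = \<omega> + m + c *s l" by blast
  then show "bil B (e m \<omega>) l = 1" using assms iso by (auto simp: bil_simps)
qed

lemma tube_translate:
  assumes m: "bil B m l = 0" and x: "x \<in> D"
  shows "tb (e m ` x) = q m + tb x"
proof -
  obtain \<omega> where \<omega>: "x = line \<omega>" "bil B \<omega> l = 1" using normalized_period[OF x] .
  obtain c where c: "e m \<omega> = \<omega> + m + c *s l" using e_normalized(1)[OF m \<omega>(2)] by blast
  have "tb (e m ` x) = q (e m \<omega> - w')"
    unfolding \<omega>(1) linear_image_line[OF eichler_linear] by (rule tube_line[OF e_normalized(2)[OF m \<omega>(2)]])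
  also have "\<dots> = q (m + (\<omega> - w'))" unfolding q_eq c by (intro exI[of _ c]) simp
  also have "\<dots> = q m + tb x" by (simp add: q_add \<omega>(1) tube_line[OF \<omega>(2)])
  finally show ?thesis .
qed

text \<open>The points of \<open>\<X>(I)\<close>.\<close>

definition "orbit x = {g ` x | g. g \<in> UZ}"

lemma XI_orbits: "XI B D \<Gamma> I = orbit ` D"
  by (auto simp: XI_def orbit_def)

text \<open>
  The tube realization turns a \<open>U(I)\<^sub>\<int>\<close>-orbit into a coset of the lattice, that is, into a
  point of the torus.
\<close>

lemma tube_orbit:
  assumes x: "x \<in> D" shows "tb ` orbit x = \<Lambda> #>\<^bsub>LIC\<^esub> tb x"
proof -
  have "orbit x = (\<lambda>m. e m ` x) ` {m \<in> perpQ. e m \<in> \<Gamma>}" by (auto simp: orbit_def UZ_eq)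
  then have "tb ` orbit x = (\<lambda>m. q m + tb x) ` {m \<in> perpQ. e m \<in> \<Gamma>}"
    by (auto simp: image_image tube_translate perpQ_bil x intro!: image_cong)
  also have "\<dots> = \<Lambda> #>\<^bsub>LIC\<^esub> tb x" by (auto simp: UI_lattice_eq r_coset_def LIC_simps)
  finally show ?thesis .
qed

text \<open>
  The sign is invisible on \<open>\<D>\<close>, whose points are lines. This is how \<open>- e m\<close> comes to act as a
  translation.
\<close>

lemma neg_e_image: assumes "x \<in> D" shows "neg_e m ` x = e m ` x"
proof -
  obtain \<omega> where \<omega>: "x = line \<omega>" using normalized_period[OF assms] by metis
  have "neg_e m ` x = uminus ` e m ` x" by (simp only: image_comp)
  then show ?thesis by (simp add: \<omega> linear_image_line[OF eichler_linear] uminus_line)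
qed

text \<open>
  Transvections commute, so that \<open>U(I)\<^sub>\<int> g\<close> maps the orbit of \<open>x\<close> onto a single orbit.
\<close>

lemma XI_action_transvection:
  assumes m: "m \<in> perpQ" and g: "g = e m \<or> g = neg_e m" and x: "x \<in> D"
  shows "XI_action (cls g) (orbit x) = orbit (e m ` x)"
proof -
  have "(u \<circ> g) ` e n ` x = (u \<circ> e n) ` e m ` x" if n: "n \<in> perpQ" for u n
  proof -
    have "e n ` x \<in> D" using GQ_D(6)[OF e_GQ[OF n]] x by blast
    then have "g ` e n ` x = e m ` e n ` x" using g neg_e_image by blast
    also have "\<dots> = (e m \<circ> e n) ` x" by (simp only: image_comp)
    also have "\<dots> = (e n \<circ> e m) ` x" by (simp only: e_comp[OF m n] e_comp[OF n m] add.commute)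
    finally show ?thesis by (simp only: image_comp[symmetric])
  qed
  moreover have "\<exists>n. n \<in> perpQ \<and> u = e n" if "u \<in> UZ" for u using that by (auto simp: UZ_eq)
  ultimately have *: "(u \<circ> g) ` u' ` x = (u \<circ> u') ` e m ` x" if "u' \<in> UZ" for u u' using that by metis
  have cls: "u \<circ> u' \<in> UZ" if "u \<in> UZ" "u' \<in> UZ" for u u'
    using perm_group_UZ that by (auto simp: perm_group_def)
  have id: "id \<in> UZ" using perm_group_UZ by (simp add: perm_group_def)
  show ?thesis
  proof
    show "XI_action (cls g) (orbit x) \<subseteq> orbit (e m ` x)"
    proof
      fix y assume "y \<in> XI_action (cls g) (orbit x)"
      then obtain u u' where "u \<in> UZ" "u' \<in> UZ" "y = (u \<circ> g) ` u' ` x"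
        unfolding XI_action_def comp_group_coset orbit_def by blast
      then have "y = (u \<circ> u') ` e m ` x" "u \<circ> u' \<in> UZ" using *[of u' u] cls by simp_all
      then show "y \<in> orbit (e m ` x)" unfolding orbit_def by blast
    qed
    show "orbit (e m ` x) \<subseteq> XI_action (cls g) (orbit x)"
    proof
      fix y assume "y \<in> orbit (e m ` x)"
      then obtain u where u: "u \<in> UZ" "y = u ` e m ` x" unfolding orbit_def by blast
      have "(u \<circ> g) ` id ` x = (u \<circ> id) ` e m ` x" by (rule *[OF id])
      then have "y = (u \<circ> g) ` id ` x" by (simp only: u(2) comp_id)
      then show "y \<in> XI_action (cls g) (orbit x)"
        using u(1) id unfolding XI_action_def comp_group_coset orbit_def by blast
    qed
  qed
qed

section \<open>Translations of the quotient by the unipotent group\<close>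

lemma D_nonempty: "D \<noteq> {}"
  using D nonempty_connected_components_of unfolding period_components_def by blast

lemma transvection_translates:
  assumes m: "m \<in> perpQ" and g: "g = e m \<or> g = neg_e m" and t: "t \<in> carrier TT"
  shows "acts_by_translation B D \<Gamma> I l w' (cls g) t \<longleftrightarrow> t = \<Lambda> #>\<^bsub>LIC\<^esub> q m"
proof -
  interpret TT: group TT by (rule group_TT)
  have qm: "q m \<in> carrier LIC" using perpC_closed(4)[OF m] by (simp add: LIC_simps)
  have qT: "\<Lambda> #>\<^bsub>LIC\<^esub> q m \<in> carrier TT" using perpC_closed(4)[OF m] by (simp add: carrier_TT)
  have "(tb ` XI_action (cls g) (orbit x) = tb ` orbit x \<otimes>\<^bsub>TT\<^esub> t) \<longleftrightarrow> t = \<Lambda> #>\<^bsub>LIC\<^esub> q m"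
    if x: "x \<in> D" for x
  proof -
    have ex: "e m ` x \<in> D" using GQ_D(6)[OF e_GQ[OF m]] x by blast
    have "tb ` XI_action (cls g) (orbit x) = \<Lambda> #>\<^bsub>LIC\<^esub> (q m + tb x)"
      by (simp add: XI_action_transvection[OF m g x] tube_orbit[OF ex] tube_translate[OF perpQ_bil[OF m] x])
    also have "\<dots> = (\<Lambda> #>\<^bsub>LIC\<^esub> tb x) \<otimes>\<^bsub>TT\<^esub> (\<Lambda> #>\<^bsub>LIC\<^esub> q m)"
      by (simp add: UI_lattice_coset_add[OF tube_carrier[OF x] qm] add.commute)
    also have "\<dots> = tb ` orbit x \<otimes>\<^bsub>TT\<^esub> (\<Lambda> #>\<^bsub>LIC\<^esub> q m)" by (simp add: tube_orbit[OF x])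
    finally have eq: "tb ` XI_action (cls g) (orbit x) = tb ` orbit x \<otimes>\<^bsub>TT\<^esub> (\<Lambda> #>\<^bsub>LIC\<^esub> q m)" .
    have "tb ` orbit x \<in> carrier TT"
      using tube_carrier[OF x] by (auto simp: tube_orbit[OF x] carrier_TT LIC_simps)
    then show ?thesis unfolding eq using TT.Units_l_cancel[OF _ qT t] TT.Units_eq by auto
  qed
  then show ?thesis unfolding acts_by_translation_def XI_orbits using D_nonempty by blast
qed

text \<open>
  Eliminating \<open>c\<close> with the help of a coordinate \<open>l\<^sub>j \<noteq> 0\<close> shows that \<open>s (v - (v\<^sub>j / l\<^sub>j) l)\<close> is
  rational. The vector multiplied by \<open>s\<close> is rational as well, hence zero.
\<close>

lemma irrational_multiple_rational:
  assumes s: "s \<notin> \<rat>" and v: "v \<in> lat \<rat>" and r: "s *s v - r = c *s l" "r \<in> lat \<rat>"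
  shows "\<exists>c. v = c *s l"
proof -
  obtain j where j: "l $ j \<noteq> 0" using l_nz by (auto simp: vec_eq_iff)
  have lQ: "l \<in> lat \<rat>" by (rule lat_Ints_Rats[OF l_int])
  define a where "a = v $ j / l $ j"
  have "v $ i = a * l $ i" for i
  proof (rule ccontr)
    define d where "d = v $ i - a * l $ i"
    assume "v $ i \<noteq> a * l $ i"
    then have d0: "d \<noteq> 0" by (simp add: d_def)
    have "s * v $ k - r $ k = c * l $ k" for k using r(1) by (simp add: vec_eq_iff)
    from this[of i] this[of j] have "s * d = r $ i - r $ j / l $ j * l $ i"
      using j by (simp add: d_def a_def field_simps) algebra
    moreover have "r $ i - r $ j / l $ j * l $ i \<in> \<rat>" "d \<in> \<rat>"
      using r(2) lQ v unfolding d_def a_def lat_def by (auto intro!: Rats_diff Rats_mult Rats_divide)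
    ultimately have "s * d / d \<in> \<rat>" by (metis Rats_divide)
    then show False using d0 s by simp
  qed
  then have "v = a *s l" by (simp add: vec_eq_iff)
  then show ?thesis ..
qed

lemma irrational_real: obtains s :: real where "complex_of_real s \<notin> \<rat>"
proof -
  have "\<exists>s. complex_of_real s \<notin> \<rat>"
  proof (rule ccontr)
    assume "\<not> (\<exists>s. complex_of_real s \<notin> \<rat>)"
    then have "range complex_of_real \<subseteq> \<rat>" by blast
    then have "countable (range complex_of_real)" using countable_rat countable_subset by blast
    then have "countable (UNIV :: real set)"
      using countable_image_inj_on[of complex_of_real UNIV] inj_of_real by blast
    then show False using uncountable_UNIV_real by blast
  qed
  then show thesis using that by blast
qed

text \<open>
  The displacement \<open>\<epsilon> g \<omega> - \<omega> - n\<close> is rational modulo \<open>l\<close> for all normalized periods, since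
  translations of the torus are only determined up to the rational lattice \<open>U(I)\<^sub>\<int>\<close>. Comparing
  its values at \<open>\<omega>\<close> and at \<open>e (s m) \<omega>\<close>, with \<open>s\<close> a fixed irrational number, leaves
  \<open>s (\<epsilon> g m - m)\<close>, which therefore is rational modulo \<open>l\<close>; this forces \<open>\<epsilon> g m - m\<close> to be a
  multiple of \<open>l\<close>.
\<close>

lemma translation_imp_transvection:
  assumes g: "g \<in> GZ" and t: "t \<in> carrier TT" and tr: "acts_by_translation B D \<Gamma> I l w' (cls g) t"
  shows "\<exists>m\<in>perpQ. g = e m \<or> g = neg_e m"
proof -
  have gQ: "g \<in> GQ" using g GZ_GQ by blast
  obtain \<epsilon> where \<epsilon>: "\<epsilon> = 1 \<or> \<epsilon> = -1" "g l = \<epsilon> *s l" using GQ_sign[OF gQ] .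
  note lin = linear_simps[OF GQ_D(1)[OF gQ]]
  \<comment> \<open>The translation \<open>t\<close> is the class of some complex \<open>n\<close>, not known to be rational at this point.\<close>
  obtain n where n: "n \<in> perp B I UNIV" "t = \<Lambda> #>\<^bsub>LIC\<^esub> q n" using t by (auto simp: carrier_TT)
  have disp: "\<exists>m\<in>perpQ. \<exists>c. \<epsilon> *s g \<omega> - \<omega> - n = m + c *s l" if "line \<omega> \<in> D" "bil B \<omega> l = 1" for \<omega>
  proof -
    have id: "id \<in> UZ" using perm_group_UZ by (simp add: perm_group_def)
    have "(id \<circ> g) ` id ` line \<omega> \<in> XI_action (cls g) (orbit (line \<omega>))"
      unfolding XI_action_def comp_group_coset orbit_def using id by blast
    then have "tb (g ` line \<omega>) \<in> tb ` XI_action (cls g) (orbit (line \<omega>))" by simp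
    also have "\<dots> = tb ` orbit (line \<omega>) \<otimes>\<^bsub>TT\<^esub> t"
      using tr that(1) unfolding acts_by_translation_def XI_orbits by blast
    also have "\<dots> = \<Lambda> #>\<^bsub>LIC\<^esub> (tb (line \<omega>) + q n)"
      using n tube_orbit[OF that(1)] UI_lattice_coset_add[OF tube_carrier[OF that(1)], of "q n"]
      by (simp add: LIC_simps)
    finally obtain m where m: "m \<in> perpQ" "tb (g ` line \<omega>) = q m + (tb (line \<omega>) + q n)"
      by (auto simp: r_coset_def LIC_simps UI_lattice_eq)
    have "\<epsilon> * bil B (g \<omega>) l = 1"
      using GQ_D(2)[OF gQ, of \<omega> l] \<epsilon>(2) that(2) by (simp add: bil_simps)
    then have n1: "bil B (\<epsilon> *s g \<omega>) l = 1" by (simp add: bil_simps)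
    have "g ` line \<omega> = line (\<epsilon> *s g \<omega>)"
      using \<epsilon>(1) uminus_line[of "g \<omega>"] linear_image_line[OF linear_uminus, of "g \<omega>"]
      by (auto simp: linear_image_line[OF GQ_D(1)[OF gQ]])
    then have "tb (g ` line \<omega>) = q (\<epsilon> *s g \<omega> - w')" using tube_line[OF n1] by simp
    then have "q (\<epsilon> *s g \<omega> - w') = q (m + (\<omega> - w' + n))"
      using m tube_line[OF that(2)] by (simp add: q_add)
    then obtain c where "\<epsilon> *s g \<omega> - w' - (m + (\<omega> - w' + n)) = c *s l" unfolding q_eq ..
    then have "\<epsilon> *s g \<omega> - \<omega> - n = m + c *s l" by (simp add: algebra_simps)
    then show ?thesis using m(1) by blast
  qed
  obtain x where "x \<in> D" using D_nonempty by blast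
  then obtain \<omega> where \<omega>: "line \<omega> \<in> D" "bil B \<omega> l = 1" using normalized_period by metis
  obtain m0 c0 where m0: "m0 \<in> perpQ" "\<epsilon> *s g \<omega> - \<omega> - n = m0 + c0 *s l" using disp[OF \<omega>] by blast
  obtain s where s: "complex_of_real s \<notin> \<rat>" using irrational_real .
  show ?thesis
  proof (rule sign_twist_unipotent[OF gQ \<epsilon>])
    fix m assume m: "m \<in> perpQ"
    \<comment> \<open>A real but irrational multiple of \<open>m\<close> still gives a transvection preserving \<open>\<D>\<close>.\<close>
    define sm where "sm = complex_of_real s *s m"
    have sm: "sm \<in> lat \<real>" "bil B sm l = 0"
      using m lat_Rats_Reals[of m] by (auto simp: sm_def mem_perp bil_simps lat_def)
    obtain a where a: "e sm \<omega> = \<omega> + sm + a *s l" using e_normalized(1)[OF sm(2) \<omega>(2)] by blast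
    have "line (e sm \<omega>) \<in> D"
      using real_transvection_D[OF sm \<omega>(1)] by (simp add: linear_image_line[OF eichler_linear])
    then obtain m1 c1 where m1: "m1 \<in> perpQ" "\<epsilon> *s g (e sm \<omega>) - e sm \<omega> - n = m1 + c1 *s l"
      using disp e_normalized(2)[OF sm(2) \<omega>(2)] by blast
    have "g (e sm \<omega>) = g \<omega> + of_real s *s g m + (a * \<epsilon>) *s l"
      unfolding a unfolding sm_def by (simp add: lin \<epsilon>(2) vector_smult_assoc)
    then have "of_real s *s (\<epsilon> *s g m - m) =
        (\<epsilon> *s g (e sm \<omega>) - e sm \<omega> - n) - (\<epsilon> *s g \<omega> - \<omega> - n) + (a - \<epsilon> * a * \<epsilon>) *s l"
      unfolding a unfolding sm_def by (simp add: vec_eq_iff algebra_simps)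
    also have "\<dots> = (m1 - m0) + (c1 - c0 + a - \<epsilon> * a * \<epsilon>) *s l"
      unfolding m1(2) m0(2) by (simp add: vec_eq_iff algebra_simps)
    finally have "of_real s *s (\<epsilon> *s g m - m) - (m1 - m0) = (c1 - c0 + a - \<epsilon> * a * \<epsilon>) *s l"
      by simp
    moreover have "\<epsilon> *s g m - m \<in> lat \<rat>" "m1 - m0 \<in> lat \<rat>"
      using perpQ_closed(2)[OF sign_perpQ[OF GQ_perpQ[OF gQ m] \<epsilon>(1)] m] perpQ_closed(2)[OF m1(1) m0(1)]
      by (simp_all add: mem_perp)
    ultimately show "\<exists>c. \<epsilon> *s g m - m = c *s l" using irrational_multiple_rational[OF s] by blast
  qed
qed

text \<open>
  A translating element is \<open>e m\<close> or \<open>- e m\<close>, and it translates by \<open>q m\<close>. The translation is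
  nonzero precisely when \<open>e m \<notin> \<Gamma>\<close>; this leaves \<open>- e m \<in> \<Gamma>\<close> and \<open>-id \<notin> \<Gamma>\<close>.
\<close>

lemma nonzero_translations_eq:
  "nonzero_translations B D \<Gamma> I l w' =
    {\<Lambda> #>\<^bsub>LIC\<^esub> q m | m. m \<in> perpQ \<and> neg_e m \<in> \<Gamma> \<and> uminus \<notin> \<Gamma>}"
proof -
  have LIC: "q m \<in> carrier LIC" "\<Lambda> #>\<^bsub>LIC\<^esub> q m \<in> carrier TT" if "m \<in> perpQ" for m
    using perpC_closed(4)[OF that] by (auto simp: LIC_simps carrier_TT)
  have triv: "\<Lambda> #>\<^bsub>LIC\<^esub> q m = \<Lambda> \<longleftrightarrow> e m \<in> \<Gamma>" if m: "m \<in> perpQ" for m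
  proof -
    interpret comm_group LIC by (rule comm_group_LIC)
    have "\<Lambda> #>\<^bsub>LIC\<^esub> q m = \<Lambda> \<longleftrightarrow> q m \<in> \<Lambda>"
      using coset_join1[OF _ LIC(1)[OF m] UI_lattice_subgroup] coset_join2[OF LIC(1)[OF m] UI_lattice_subgroup] by blast
    also have "\<dots> \<longleftrightarrow> e m \<in> \<Gamma>"
      using m e_eq_iff perpQ_bil unfolding UI_lattice_eq image_iff by (metis (mono_tags, lifting) mem_Collect_eq)
    finally show ?thesis .
  qed
  show ?thesis
  proof (intro equalityI subsetI)
    fix t assume "t \<in> nonzero_translations B D \<Gamma> I l w'"
    then obtain C where t: "t \<in> carrier TT" "t \<noteq> \<Lambda>"
      and C: "C \<in> carrier G" "acts_by_translation B D \<Gamma> I l w' C t"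
      by (auto simp: nonzero_translations_def one_TT)
    obtain g where g: "g \<in> GZ" "C = cls g" using C(1) by (auto simp: carrier_G)
    obtain m where m: "m \<in> perpQ" "g = e m \<or> g = neg_e m"
      using translation_imp_transvection[OF g(1) t(1)] C(2) g(2) by blast
    have tm: "t = \<Lambda> #>\<^bsub>LIC\<^esub> q m" using transvection_translates[OF m t(1)] C(2) g(2) by blast
    then have "e m \<notin> \<Gamma>" using t(2) triv m(1) by blast
    then have "neg_e m \<in> \<Gamma>" "uminus \<notin> \<Gamma>" using m g(1) GZ_Gamma uminus_in_Gamma_iff by blast+
    then show "t \<in> {\<Lambda> #>\<^bsub>LIC\<^esub> q m | m. m \<in> perpQ \<and> neg_e m \<in> \<Gamma> \<and> uminus \<notin> \<Gamma>}" using tm m(1) by blast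
  next
    fix t assume "t \<in> {\<Lambda> #>\<^bsub>LIC\<^esub> q m | m. m \<in> perpQ \<and> neg_e m \<in> \<Gamma> \<and> uminus \<notin> \<Gamma>}"
    then obtain m where m: "m \<in> perpQ" "neg_e m \<in> \<Gamma>" "uminus \<notin> \<Gamma>" "t = \<Lambda> #>\<^bsub>LIC\<^esub> q m" by blast
    have "t \<in> carrier TT" "t \<noteq> \<one>\<^bsub>TT\<^esub>" using m LIC(2) triv uminus_in_Gamma_iff by (auto simp: one_TT)
    moreover have "cls (neg_e m) \<in> carrier G" using m neg_e_GZ_iff by (simp add: carrier_G)
    moreover have "acts_by_translation B D \<Gamma> I l w' (cls (neg_e m)) t"
      using transvection_translates[OF m(1) _ calculation(1)] m(4) by blast
    ultimately show "t \<in> nonzero_translations B D \<Gamma> I l w'" unfolding nonzero_translations_def by blast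
  qed
qed

lemma nonzero_translations_singleton:
  assumes m: "m \<in> perpQ" "neg_e m \<in> \<Gamma>" "uminus \<notin> \<Gamma>"
  shows "nonzero_translations B D \<Gamma> I l w' = {\<Lambda> #>\<^bsub>LIC\<^esub> q m}"
proof -
  have "\<Lambda> #>\<^bsub>LIC\<^esub> q m' = \<Lambda> #>\<^bsub>LIC\<^esub> q m" if m': "m' \<in> perpQ" "neg_e m' \<in> \<Gamma>" for m'
  proof -
    have "neg_e m' \<circ> inv_into UNIV (neg_e m) \<in> \<Gamma>" using m m' Gamma_comp Gamma_inv by blast
    then have "e (m' - m) \<in> \<Gamma>" using m m' by (simp add: neg_e_inv neg_e_comp perpQ_closed)
    then have "q (m' - m) \<in> \<Lambda>" using perpQ_closed(2)[OF m'(1) m(1)] by (auto simp: UI_lattice_eq)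
    moreover have "q m' = q (m' - m) + q m" by (simp add: q_add)
    ultimately show ?thesis
      using UI_lattice_coset_eq[of "q m'" "q m"] perpC_closed(4) m m' by (auto simp: LIC_simps)
  qed
  then show ?thesis unfolding nonzero_translations_eq using m by blast
qed

end

theorem proposition3p1:
  fixes B :: "int ^ 'n ^ 'n" and b :: nat
    and \<D> :: "(complex ^ 'n) set set"
    and \<Gamma> :: "(complex ^ 'n \<Rightarrow> complex ^ 'n) set"
    and I I' :: "(complex ^ 'n) set"
    and l \<omega>' :: "complex ^ 'n"
  assumes "is_lattice B" and "has_signature B 2 b"
    and "\<D> \<in> period_components B"
    and "finite_index_subgroup \<Gamma> (comp_group (Oplus B \<D>))"
    and "rank_one_sublattice I" and "primitive I" and "isotropic B I"
    and "tube_data B I l I' \<omega>'"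
  defines "U \<equiv> UI_Z B \<D> \<Gamma> I" and "U' \<equiv> UI_Z' B \<D> \<Gamma> I"
    and "E \<equiv> transvection B I"
    and "G \<equiv> GammaI_bar B \<D> \<Gamma> I"
    and "\<rho> \<equiv> natural_map B \<D> \<Gamma> I"
    and "T \<equiv> nonzero_translations B \<D> \<Gamma> I l \<omega>'"
  defines "cond1 \<equiv> U \<noteq> U'"
    and "cond2 \<equiv> uminus \<notin> \<Gamma> \<and> (\<exists>w\<in>LI B I \<rat>. uminus \<circ> E w \<in> GammaI_Z B \<D> \<Gamma> I)"
    and "cond3 \<equiv> uminus \<notin> \<Gamma> \<and> \<not> inj_on \<rho> (carrier G)"
    and "cond4 \<equiv> T \<noteq> {}"
  shows "(cond1 \<longleftrightarrow> cond2) \<and> (cond2 \<longleftrightarrow> cond3) \<and> (cond3 \<longleftrightarrow> cond4) \<and>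
    (cond2 \<longrightarrow> (\<forall>w\<in>LI B I \<rat>. uminus \<circ> E w \<in> GammaI_Z B \<D> \<Gamma> I \<longrightarrow>
       (let Q = comp_group U' Mod U;
            N = kernel G (Oplus_UI B \<D> \<Gamma> I) \<rho> in
          carrier Q = generate Q {U #>\<^bsub>comp_group U'\<^esub> E w} \<and>
          Q \<cong> integer_mod_group 2 \<and>
          N = generate G {U #>\<^bsub>comp_group (GammaI_Z B \<D> \<Gamma> I)\<^esub> (uminus \<circ> E w)} \<and>
          G\<lparr>carrier := N\<rparr> \<cong> integer_mod_group 2 \<and>
          T = {UI_lattice B \<D> \<Gamma> I #>\<^bsub>LI_group B I UNIV\<^esub> w})))"
proof -
  have I_eq: "I = ext \<int> {l}" and pair: "bil B \<omega>' l = 1"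
    and w': "\<omega>' \<in> ext \<rat> I'" "rank_one_sublattice I'"
    using \<open>tube_data B I l I' \<omega>'\<close> by (auto simp: tube_data_def)
  have lI: "l \<in> I" unfolding I_eq ext_def by (auto intro!: exI[of _ 1])
  have latI: "x \<in> lat \<int>" if "rank_one_sublattice J" "x \<in> J" for J and x :: "complex ^ 'n"
    using that by (auto simp: rank_one_sublattice_def ext_def intro!: lat_Ints_closed)
  interpret cusp B I l \<omega>' \<D> \<Gamma> b
  proof
    show "transpose B = B" using \<open>is_lattice B\<close> by (simp add: is_lattice_def)
    show "l \<in> lat \<int>" by (rule latI[OF \<open>rank_one_sublattice I\<close> lI])
    show "bil B l l = 0" using \<open>isotropic B I\<close> lI by (simp add: isotropic_def)
    show "\<omega>' \<in> lat \<rat>"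
      using w'(1) latI[OF w'(2)] lat_Ints_Rats by (auto simp: ext_def intro!: lat_Rats_closed)
  qed (fact I_eq pair assms)+
  have LIQ: "LI B I \<rat> = (\<lambda>m. tens I m l) ` perp B I \<rat>" by (simp add: LI_eq)
  have Eq: "E (tens I m l) = eichler B m l" if "m \<in> perp B I \<rat>" for m
    unfolding E_def by (rule transvection_q[OF perpQ_bil[OF that]])
  \<comment> \<open>The common reformulation of the four conditions.\<close>
  define R where "R \<longleftrightarrow> uminus \<notin> \<Gamma> \<and> (\<exists>m\<in>perp B I \<rat>. uminus \<circ> eichler B m l \<in> \<Gamma>)"
  have c1: "cond1 \<longleftrightarrow> R" unfolding cond1_def U_def U'_def R_def by (rule UZ_neq_U'_iff)
  have c2: "cond2 \<longleftrightarrow> R" unfolding cond2_def R_def LIQ by (auto simp: Eq neg_e_GZ_iff)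
  have c3: "cond3 \<longleftrightarrow> R" unfolding cond3_def \<rho>_def G_def R_def natural_map_not_inj_iff ..
  have c4: "cond4 \<longleftrightarrow> R" unfolding cond4_def T_def R_def nonzero_translations_eq by blast
  show ?thesis
  proof (intro conjI impI ballI)
    fix w assume "cond2" and w: "w \<in> LI B I \<rat>" "uminus \<circ> E w \<in> GammaI_Z B \<D> \<Gamma> I"
    then have nm: "uminus \<notin> \<Gamma>" by (simp add: cond2_def)
    obtain m where m: "m \<in> perp B I \<rat>" "w = tens I m l" using w(1) LIQ by blast
    have Ew: "E w = eichler B m l" using Eq m by simp
    have mG: "uminus \<circ> eichler B m l \<in> \<Gamma>" using w(2) GZ_Gamma unfolding Ew by blast
    show "let Q = comp_group U' Mod U;
            N = kernel G (Oplus_UI B \<D> \<Gamma> I) \<rho> in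
          carrier Q = generate Q {U #>\<^bsub>comp_group U'\<^esub> E w} \<and>
          Q \<cong> integer_mod_group 2 \<and>
          N = generate G {U #>\<^bsub>comp_group (GammaI_Z B \<D> \<Gamma> I)\<^esub> (uminus \<circ> E w)} \<and>
          G\<lparr>carrier := N\<rparr> \<cong> integer_mod_group 2 \<and>
          T = {UI_lattice B \<D> \<Gamma> I #>\<^bsub>LI_group B I UNIV\<^esub> w}"
      unfolding Let_def Ew U_def U'_def G_def \<rho>_def T_def unfolding m(2)
      by (intro conjI saturation_quotient[OF m(1) mG nm] kernel_natural_map[OF m(1) mG]
          nonzero_translations_singleton[OF m(1) mG nm])
  qed (use c1 c2 c3 c4 in blast)+
qed

end
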